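(* Let $n\in\mathbb{N}=\{0,1,2,\dots\}$ and let $G\in L^1(\mathbb{R}^+)\cap L^\infty(\mathbb{R}^+)$ be a complex valued function that satisfies $$\int_{\mathbb{R}^+}t^4|G(t)|^2dt<+\infty,\qquad \int_{\mathbb{R}^+}t^n|G(t)|dt<+\infty\qquad\text{and}\qquad D_G(\omega)\neq0\ \text{ for all }\omega\in\Pi^-.$$ Then there exists $C_{n,G}\in\mathbb{R}^+$ such that for every complex valued function $F$ on $\mathbb{R}^+$ (measurable and bounded on bounded intervals), the solution $R$ of the Volterra equation $$R(t)=F(t)+\int_0^tG(t-s)R(s)ds,\qquad \forall t\in\mathbb{R}^+,$$ satisfies $$\sup_{t\in[0,T]}(1+t)^n|R(t)|\leq C_{n,G}\sup_{t\in[0,T]}(1+t)^n|F(t)|,\qquad\forall T>0.$$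
   Context: $\mathbb{R}^+=[0,+\infty)$ and $\Pi^-=\{z\in\mathbb{C}:\ \mathrm{Im}(z)\leq0\}$. For $G\in L^1(\mathbb{R}^+)$, $D_G(\omega)=1-\int_{\mathbb{R}^+}G(t)e^{-i\omega t}dt$ for $\omega\in\Pi^-$. The Volterra equation has a unique solution $R$ (measurable and bounded on bounded intervals) for each such $F$. *)

theory Defs
  imports "HOL-Analysis.Analysis"
begin

text \<open>
  Complex-valued functions on \<open>[0,\<infinity>)\<close> are represented by functions of type \<open>real \<Rightarrow> complex\<close>
  whose values on the negative half-line are never inspected. Measurability and integrals are
  meant with respect to Lebesgue measure; in particular \<open>G absolutely_integrable_on {0..}\<close> is
  \<open>set_integrable lebesgue {0..} G\<close>, i.e. \<open>G \<in> L\<^sup>1([0,\<infinity>))\<close>.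
\<close>

text \<open>Measurability is not part of the following predicate; it comes from the \<open>L\<^sup>1\<close> hypothesis.\<close>

definition essentially_bounded_on :: "(real \<Rightarrow> complex) \<Rightarrow> real set \<Rightarrow> bool" where
  "essentially_bounded_on G S \<longleftrightarrow> (\<exists>M::real. AE t in lebesgue. t \<in> S \<longrightarrow> cmod (G t) \<le> M)"

definition measurable_locally_bounded :: "(real \<Rightarrow> complex) \<Rightarrow> bool" where
  "measurable_locally_bounded F \<longleftrightarrow>
     F \<in> borel_measurable (lebesgue_on {0..}) \<and> (\<forall>T\<ge>0. bounded (F ` {0..T}))"

definition lower_half_plane :: "complex set" where
  "lower_half_plane = {z. Im z \<le> 0}"

definition D :: "(real \<Rightarrow> complex) \<Rightarrow> complex \<Rightarrow> complex" where
  "D G \<omega> = 1 - (LINT t:{0..}|lebesgue. G t * exp (- \<i> * \<omega> * complex_of_real t))"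

text \<open>
  The equation is required at every \<open>t \<ge> 0\<close>, not just almost everywhere. For
  \<open>G \<in> L\<^sup>1([0,\<infinity>))\<close> the integrand is integrable for every such \<open>t\<close>, because \<open>R\<close> is measurable
  and bounded on \<open>[0,t]\<close>; for every \<open>F\<close> that is measurable and bounded on bounded intervals,
  the solution exists and is unique on \<open>[0,\<infinity>)\<close>.
\<close>

definition volterra_solution ::
    "(real \<Rightarrow> complex) \<Rightarrow> (real \<Rightarrow> complex) \<Rightarrow> (real \<Rightarrow> complex) \<Rightarrow> bool" where
  "volterra_solution G F R \<longleftrightarrow>
     measurable_locally_bounded R \<and>
     (\<forall>t\<ge>0. R t = F t + (LINT s:{0..t}|lebesgue. G (t - s) * R s))"

end

(*
  If K is in L^1 and solves K = G + G * K, then R = F + K * F, which gives the unweighted bound.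
  To find K, replace G by exp(-s t) G(t). For large s the Neumann series produces K. The Fourier
  transforms of K and of t K(t) are those of G and t G(t) multiplied by powers of 1 / D_G, so
  Plancherel bounds both in L^2, and hence K in L^1, uniformly in s; a Neumann perturbation of
  fixed step size then carries the existence of K down to s = 0. This needs a lower bound for
  |D_G|, which follows from the Riemann-Lebesgue lemma and compactness in s. The weight is
  raised one power at a time, the commutator of (1 + t)^k with convolution by G being of lower
  order.
*)

theory Submission
  imports Defs "HOL-Probability.Sinc_Integral" "HOL-Probability.Characteristic_Functions"
begin

subsection \<open>Convolution of bounded integrable functions\<close>

text \<open>The obstacle is that the \<open>L1\<close> estimate of \<open>K\<close> is only a
  priori: it speaks of \<open>fourier K\<close> and so presupposes that \<open>K\<close> is
  integrable. It can therefore be used along a continuation, provided that it is uniform. It is: it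
  depends on a lower bound for \<open>cmod (1 - fourier g w)\<close> and on the \<open>L2\<close>
  norms of \<open>g\<close> and \<open>t g(t)\<close>, and damping does not increase these norms. A
  damping rate \<open>s\<close> moves the frequency from \<open>w\<close> to \<open>w - i s\<close>,
  so the half plane in the hypothesis is exactly the set of frequencies met on the way. For
  \<open>s > 0\<close> the damped \<open>t g(t)\<close> is again bounded and integrable; the value
  \<open>s = 0\<close> occurs only as the end point of the last step, where no estimate is asked
  for. The hypothesis on \<open>t^4\<close> supplies, with the square integrability of
  \<open>g\<close>, the finite \<open>L2\<close> norm of \<open>t g(t)\<close>.

  All kernels are bounded as well as integrable. Convolutions then exist at every point and are
  continuous, squares are integrable, and the equation for \<open>K\<close> holds pointwise.
  Plancherel is needed only as a comparison of \<open>L2\<close> norms, which Gaussian averages give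
  without an inverse transform.\<close>

definition bounded_L1 :: "(real \<Rightarrow> complex) \<Rightarrow> bool" where
  "bounded_L1 f \<longleftrightarrow> f \<in> borel_measurable borel \<and> integrable lborel f \<and> (\<exists>B. \<forall>t. cmod (f t) \<le> B)"

definition conv :: "(real \<Rightarrow> complex) \<Rightarrow> (real \<Rightarrow> complex) \<Rightarrow> real \<Rightarrow> complex" (infixl "\<odot>" 70) where
  "(f \<odot> g) t = (LINT s|lborel. f (t - s) * g s)"

definition l1 :: "(real \<Rightarrow> complex) \<Rightarrow> real" where
  "l1 f = (LINT t|lborel. cmod (f t))"

definition fourier :: "(real \<Rightarrow> complex) \<Rightarrow> real \<Rightarrow> complex" where
  "fourier f w = (LINT t|lborel. f t * cis (- (w * t)))"

lemma bounded_L1_measurable [measurable_dest]: "bounded_L1 f \<Longrightarrow> f \<in> borel_measurable borel"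
  and bounded_L1_integrable: "bounded_L1 f \<Longrightarrow> integrable lborel f"
  by (auto simp: bounded_L1_def)

lemma bounded_L1_bound:
  assumes "bounded_L1 f"
  obtains B where "B \<ge> 0" "\<And>t. cmod (f t) \<le> B"
  using assms unfolding bounded_L1_def by (meson norm_ge_zero order_trans)

lemma bounded_L1_integrable_norm: "bounded_L1 f \<Longrightarrow> integrable lborel (\<lambda>t. cmod (f t))"
  by (auto intro: bounded_L1_integrable)

lemma bounded_L1_add: "bounded_L1 f \<Longrightarrow> bounded_L1 g \<Longrightarrow> bounded_L1 (\<lambda>t. f t + g t)"
  unfolding bounded_L1_def by (auto intro: norm_triangle_mono)

lemma bounded_L1_diff: "bounded_L1 f \<Longrightarrow> bounded_L1 g \<Longrightarrow> bounded_L1 (\<lambda>t. f t - g t)"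
  unfolding bounded_L1_def by auto (meson add_mono norm_triangle_ineq4 order_trans)

lemma bounded_L1_mult:
  assumes f: "bounded_L1 f" and m: "m \<in> borel_measurable borel" and b: "\<And>t. cmod (m t) \<le> c"
  shows "bounded_L1 (\<lambda>t. m t * f t)"
proof -
  obtain B where B: "B \<ge> 0" "\<And>t. cmod (f t) \<le> B" using bounded_L1_bound[OF f] by blast
  have c: "c \<ge> 0" using b[of 0] norm_ge_zero order_trans by blast
  have [measurable]: "f \<in> borel_measurable borel" "m \<in> borel_measurable borel" using f m by (auto simp: bounded_L1_def)
  have "integrable lborel (\<lambda>t. m t * f t)"
    by (rule Bochner_Integration.integrable_bound[OF integrable_mult_right[OF bounded_L1_integrable[OF f], of "of_real c"]])
       (use b c in \<open>auto simp: norm_mult intro!: mult_right_mono\<close>)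
  moreover have "cmod (m t * f t) \<le> c * B" for t
    using b[of t] B c by (auto simp: norm_mult intro!: mult_mono)
  ultimately show ?thesis unfolding bounded_L1_def by auto
qed

lemma bounded_L1_norm: "bounded_L1 f \<Longrightarrow> bounded_L1 (\<lambda>t. of_real (cmod (f t)))"
  unfolding bounded_L1_def by auto

lemma integrable_translate: "integrable lborel (f :: real \<Rightarrow> 'a::{banach, second_countable_topology}) \<Longrightarrow> integrable lborel (\<lambda>t. f (t - s))"
  using lborel_integrable_real_affine[of f 1 "-s"] by simp

lemma integral_translate: "(LINT t|lborel. (f :: real \<Rightarrow> 'a::{banach, second_countable_topology}) (t - s)) = (LINT t|lborel. f t)"
  using lborel_integral_real_affine[of 1 f "-s"] by simp

lemma integrable_reflect: "integrable lborel (f :: real \<Rightarrow> 'a::{banach, second_countable_topology}) \<Longrightarrow> integrable lborel (\<lambda>s. f (t - s))"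
  using lborel_integrable_real_affine[of f "-1" t] by simp

lemma integral_reflect: "(LINT s|lborel. (f :: real \<Rightarrow> 'a::{banach, second_countable_topology}) (t - s)) = (LINT t|lborel. f t)"
  using lborel_integral_real_affine[of "-1" f t] by simp

lemma bounded_L1_translate: "bounded_L1 f \<Longrightarrow> bounded_L1 (\<lambda>t. f (t - s))"
  unfolding bounded_L1_def by (auto intro: integrable_translate)

lemma bounded_L1_reflect: "bounded_L1 f \<Longrightarrow> bounded_L1 (\<lambda>s. f (t - s))"
  unfolding bounded_L1_def by (auto intro: integrable_reflect)

lemma bounded_L1_times:
  assumes "bounded_L1 f" "bounded_L1 g" shows "bounded_L1 (\<lambda>t. f t * g t)"
proof -
  obtain B where "\<And>t. cmod (f t) \<le> B" using bounded_L1_bound[OF assms(1)] by blast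
  then show ?thesis by (intro bounded_L1_mult[of _ _ B] assms) (use assms in \<open>auto simp: bounded_L1_def\<close>)
qed

lemma conv_integrable: "bounded_L1 f \<Longrightarrow> bounded_L1 g \<Longrightarrow> integrable lborel (\<lambda>s. f (t - s) * g s)"
  by (intro bounded_L1_integrable bounded_L1_times bounded_L1_reflect)

lemma conv_pair_integrable:
  assumes f: "bounded_L1 f" and g: "bounded_L1 g"
  shows "integrable (lborel \<Otimes>\<^sub>M lborel) (\<lambda>(s,t). f (t - s) * g s)"
proof (rule lborel_pair.Fubini_integrable)
  note [measurable] = bounded_L1_measurable[OF f] bounded_L1_measurable[OF g]
  show "(\<lambda>(s,t). f (t - s) * g s) \<in> borel_measurable (lborel \<Otimes>\<^sub>M lborel)" by measurable
  have "(LINT t|lborel. norm (f (t - s) * g s)) = cmod (g s) * l1 f" for s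
    using integral_translate[of "\<lambda>t. cmod (f t)" s] by (simp add: norm_mult l1_def)
  then show "integrable lborel (\<lambda>s. LINT t|lborel. norm (case (s,t) of (s,t) \<Rightarrow> f (t - s) * g s))"
    using bounded_L1_integrable_norm[OF g] by simp
  show "AE s in lborel. integrable lborel (\<lambda>t. case (s,t) of (s,t) \<Rightarrow> f (t - s) * g s)"
    using integrable_translate[OF bounded_L1_integrable[OF f]] by simp
qed

lemma integral_conv:
  assumes "bounded_L1 f" "bounded_L1 g"
  shows "(LINT t|lborel. (f \<odot> g) t) = (LINT t|lborel. f t) * (LINT t|lborel. g t)"
proof -
  have "(LINT t|lborel. (f \<odot> g) t) = (LINT s|lborel. LINT t|lborel. f (t - s) * g s)"
    unfolding conv_def by (rule lborel_pair.Fubini_integral[OF conv_pair_integrable[OF assms]])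
  then show ?thesis by (simp add: integral_translate)
qed

lemma conv_integrable_line:
  assumes "bounded_L1 f" "bounded_L1 g" shows "integrable lborel (f \<odot> g)"
  using lborel_pair.integrable_snd[of "\<lambda>s t. f (t - s) * g s"] conv_pair_integrable[OF assms]
  unfolding conv_def[abs_def] by simp

lemma norm_conv_le:
  assumes "bounded_L1 f" "bounded_L1 g"
  shows "cmod ((f \<odot> g) t) \<le> (LINT s|lborel. cmod (f (t - s)) * cmod (g s))"
  unfolding conv_def by (rule order_trans[OF integral_norm_bound]) (simp add: norm_mult)

text \<open>The factor \<open>cmod (f (t - s))\<close> stands on both sides of the hypothesis, so
  \<open>B\<close> has to bound \<open>g\<close> only where \<open>f (t - s)\<close> does not
  vanish. For causal \<open>f\<close> this means only at \<open>s \<le> t\<close>.\<close>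

lemma norm_conv_le_l1:
  assumes f: "bounded_L1 f" and g: "bounded_L1 g" and b: "AE s in lborel. cmod (f (t - s)) * cmod (g s) \<le> cmod (f (t - s)) * B"
  shows "cmod ((f \<odot> g) t) \<le> l1 f * B"
proof -
  have "cmod ((f \<odot> g) t) \<le> (LINT s|lborel. cmod (f (t - s)) * cmod (g s))"
    by (rule norm_conv_le[OF f g])
  also have "\<dots> \<le> (LINT s|lborel. cmod (f (t - s)) * B)"
    using conv_integrable[OF f g, of t, THEN integrable_norm] integrable_reflect[OF bounded_L1_integrable_norm[OF f], of t]
    by (intro integral_mono_AE b) (auto simp: norm_mult)
  also have "\<dots> = l1 f * B"
    by (simp add: integral_reflect[of "\<lambda>s. cmod (f s)"] l1_def)
  finally show ?thesis .
qed

lemma bounded_L1_conv: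
  assumes f: "bounded_L1 f" and g: "bounded_L1 g"
  shows "bounded_L1 (f \<odot> g)"
proof -
  note [measurable] = bounded_L1_measurable[OF f] bounded_L1_measurable[OF g]
  have "f \<odot> g \<in> borel_measurable borel" unfolding conv_def[abs_def] by measurable
  moreover obtain B where B: "B \<ge> 0" "\<And>t. cmod (g t) \<le> B" using bounded_L1_bound[OF g] by blast
  then have "cmod ((f \<odot> g) t) \<le> l1 f * B" for t
    by (intro norm_conv_le_l1[OF f g]) (auto intro!: mult_left_mono)
  ultimately show ?thesis using conv_integrable_line[OF f g] unfolding bounded_L1_def by blast
qed

lemma l1_nonneg [simp]: "l1 f \<ge> 0" unfolding l1_def by simp

lemma l1_add:
  assumes "bounded_L1 f" "bounded_L1 g" shows "l1 (\<lambda>t. f t + g t) \<le> l1 f + l1 g"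
proof -
  note I = assms[THEN bounded_L1_integrable_norm]
  have "l1 (\<lambda>t. f t + g t) \<le> (LINT t|lborel. cmod (f t) + cmod (g t))"
    unfolding l1_def by (intro integral_mono bounded_L1_integrable_norm bounded_L1_add assms Bochner_Integration.integrable_add I norm_triangle_ineq)
  then show ?thesis using I by (simp add: l1_def)
qed

lemma l1_conv:
  assumes f: "bounded_L1 f" and g: "bounded_L1 g"
  shows "l1 (f \<odot> g) \<le> l1 f * l1 g"
proof -
  \<comment> \<open>The moduli stay complex valued so that \<open>integral_conv\<close> applies to
    them; injectivity of \<open>of_real\<close> and the real part then give the real
    statements.\<close>
  define af where "af t = complex_of_real (cmod (f t))" for t
  define ag where "ag t = complex_of_real (cmod (g t))" for t
  have A: "bounded_L1 af" "bounded_L1 ag" unfolding af_def ag_def by (intro bounded_L1_norm f g)+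
  have eq: "(af \<odot> ag) t = of_real (LINT s|lborel. cmod (f (t - s)) * cmod (g s))" for t
    unfolding conv_def af_def ag_def of_real_mult[symmetric] by (rule integral_complex_of_real)
  have "of_real (LINT t|lborel. (LINT s|lborel. cmod (f (t - s)) * cmod (g s))) = (LINT t|lborel. (af \<odot> ag) t)"
    unfolding eq by (rule integral_complex_of_real[symmetric])
  also have "\<dots> = complex_of_real (l1 f * l1 g)"
    unfolding integral_conv[OF A] l1_def af_def ag_def of_real_mult by (simp only: integral_complex_of_real)
  finally have I: "(LINT t|lborel. (LINT s|lborel. cmod (f (t - s)) * cmod (g s))) = l1 f * l1 g"
    by (simp only: of_real_eq_iff)
  have "integrable lborel (\<lambda>t. Re ((af \<odot> ag) t))"
    using conv_integrable_line[OF A] by (intro integrable_Re)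
  then have J: "integrable lborel (\<lambda>t. LINT s|lborel. cmod (f (t - s)) * cmod (g s))" by (simp add: eq)
  have "l1 (f \<odot> g) \<le> (LINT t|lborel. (LINT s|lborel. cmod (f (t - s)) * cmod (g s)))"
    unfolding l1_def by (intro integral_mono J norm_conv_le f g bounded_L1_integrable_norm bounded_L1_conv)
  then show ?thesis using I by simp
qed

lemma conv_commute: "f \<odot> g = g \<odot> f"
proof
  fix t show "(f \<odot> g) t = (g \<odot> f) t"
    unfolding conv_def using integral_reflect[of "\<lambda>s. f (t - s) * g s" t] by (simp add: mult.commute)
qed

lemma conv_assoc:
  assumes f: "bounded_L1 f" and g: "bounded_L1 g" and h: "bounded_L1 h"
  shows "(f \<odot> g) \<odot> h = f \<odot> (g \<odot> h)"
proof
  fix t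
  note [measurable] = bounded_L1_measurable[OF f] bounded_L1_measurable[OF g] bounded_L1_measurable[OF h]
  \<comment> \<open>Boundedness of \<open>f\<close> dominates the triple product by a multiple of
    the kernel of \<open>g \<odot> h\<close>, which is integrable on the plane; this licenses the
    exchange of integrals.\<close>
  obtain B where B: "B \<ge> 0" "\<And>t. cmod (f t) \<le> B" using bounded_L1_bound[OF f] by blast
  have P: "integrable (lborel \<Otimes>\<^sub>M lborel) (\<lambda>(s,v). f (t - v) * (g (v - s) * h s))"
    by (rule Bochner_Integration.integrable_bound[OF integrable_mult_right[OF conv_pair_integrable[OF g h], of "of_real B"]])
       (use B in \<open>auto simp: norm_mult mult_right_mono\<close>)
  have "((f \<odot> g) \<odot> h) t = (LINT s|lborel. (LINT u|lborel. f (t - s - u) * g u) * h s)"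
    by (simp add: conv_def)
  also have "\<dots> = (LINT s|lborel. (LINT v|lborel. f (t - v) * (g (v - s) * h s)))"
  proof (intro Bochner_Integration.integral_cong refl)
    fix s
    have "(LINT u|lborel. f (t - s - u) * g u) = (LINT v|lborel. f (t - v) * g (v - s))"
      using integral_translate[of "\<lambda>u. f (t - s - u) * g u" s] by simp
    then show "(LINT u|lborel. f (t - s - u) * g u) * h s = (LINT v|lborel. f (t - v) * (g (v - s) * h s))"
      by (simp add: mult.assoc[symmetric])
  qed
  also have "\<dots> = (LINT v|lborel. (LINT s|lborel. f (t - v) * (g (v - s) * h s)))"
    by (rule lborel_pair.Fubini_integral[OF P, symmetric])
  also have "\<dots> = (f \<odot> (g \<odot> h)) t"
    by (simp add: conv_def)
  finally show "((f \<odot> g) \<odot> h) t = (f \<odot> (g \<odot> h)) t" .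
qed

lemma conv_add_right: "bounded_L1 f \<Longrightarrow> bounded_L1 g \<Longrightarrow> bounded_L1 h \<Longrightarrow> f \<odot> (\<lambda>t. g t + h t) = (\<lambda>t. (f \<odot> g) t + (f \<odot> h) t)"
  by (auto simp: conv_def conv_integrable distrib_left)

lemma conv_diff_right: "bounded_L1 f \<Longrightarrow> bounded_L1 g \<Longrightarrow> bounded_L1 h \<Longrightarrow> f \<odot> (\<lambda>t. g t - h t) = (\<lambda>t. (f \<odot> g) t - (f \<odot> h) t)"
  by (auto simp: conv_def conv_integrable right_diff_distrib)

lemma conv_add_left: "bounded_L1 f \<Longrightarrow> bounded_L1 g \<Longrightarrow> bounded_L1 h \<Longrightarrow> (\<lambda>t. g t + h t) \<odot> f = (\<lambda>t. (g \<odot> f) t + (h \<odot> f) t)"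
  using conv_add_right[of f g h] by (simp add: conv_commute[of _ f])

lemma fourier_add: "bounded_L1 f \<Longrightarrow> bounded_L1 g \<Longrightarrow> fourier (\<lambda>t. f t + g t) w = fourier f w + fourier g w"
proof -
  assume "bounded_L1 f" "bounded_L1 g"
  moreover have "bounded_L1 f \<Longrightarrow> integrable lborel (\<lambda>t. f t * cis (- (w * t)))" for f
    using bounded_L1_integrable[OF bounded_L1_mult[of f "\<lambda>t. cis (- (w * t))" 1]]
    by (simp add: mult.commute cis_conv_exp)
  ultimately show ?thesis unfolding fourier_def by (simp add: distrib_right)
qed

lemma bounded_L1_modulate: "bounded_L1 f \<Longrightarrow> bounded_L1 (\<lambda>t. f t * cis (w * t))"
  using bounded_L1_mult[of f "\<lambda>t. cis (w * t)" 1] by (simp add: mult.commute cis_conv_exp)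

lemma fourier_conv:
  assumes f: "bounded_L1 f" and g: "bounded_L1 g"
  shows "fourier (f \<odot> g) w = fourier f w * fourier g w"
proof -
  have A: "bounded_L1 (\<lambda>t. f t * cis (- (w * t)))" "bounded_L1 (\<lambda>t. g t * cis (- (w * t)))"
    using bounded_L1_modulate[OF f, of "-w"] bounded_L1_modulate[OF g, of "-w"] by auto
  have "(f \<odot> g) t * cis (- (w * t)) = ((\<lambda>t. f t * cis (- (w * t))) \<odot> (\<lambda>t. g t * cis (- (w * t)))) t" for t
  proof -
    have "cis (- (w * t)) = cis (- (w * (t - s))) * cis (- (w * s))" for s
      by (simp add: cis_mult algebra_simps)
    then have "f (t - s) * cis (- (w * (t - s))) * (g s * cis (- (w * s))) = f (t - s) * g s * cis (- (w * t))" for s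
      by (simp add: mult_ac)
    then show ?thesis by (simp only: conv_def) simp
  qed
  then show ?thesis unfolding fourier_def using integral_conv[OF A] by simp
qed

subsection \<open>Riemann--Lebesgue lemma and Plancherel comparison\<close>

lemma l1_triangle:
  assumes "bounded_L1 f" "bounded_L1 g" "bounded_L1 h"
  shows "l1 (\<lambda>t. f t - h t) \<le> l1 (\<lambda>t. f t - g t) + l1 (\<lambda>t. g t - h t)"
  using l1_add[OF bounded_L1_diff[OF assms(1,2)] bounded_L1_diff[OF assms(2,3)]] by simp

lemma l1_swap: "l1 (\<lambda>t. f t - g t) = l1 (\<lambda>t. g t - f t)"
  by (simp add: l1_def norm_minus_commute)

lemma l1_translate: "l1 (\<lambda>t. f (t - s)) = l1 f"
  unfolding l1_def using integral_translate[of "\<lambda>t. cmod (f t)" s] .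

text \<open>The radial retraction onto the disc of radius \<open>B\<close>. It makes continuous
  approximants uniformly bounded, as dominated convergence requires, and leaves alone the values of
  the function that they approximate.\<close>

lemma clamp_complex:
  fixes B :: real assumes B: "B > 0"
  defines "cl \<equiv> \<lambda>z::complex. z /\<^sub>R max 1 (cmod z / B)"
  shows "continuous_on UNIV cl" "cmod (cl z) \<le> B" "cmod z \<le> B \<Longrightarrow> cl z = z"
proof -
  show "continuous_on UNIV cl" unfolding cl_def
    using B by (intro continuous_intros) (auto simp: max_def)
  have "cmod z \<le> B * max 1 (cmod z / B)" using B by (simp add: max_def field_simps)
  moreover have "cmod (cl z) = cmod z / max 1 (cmod z / B)" unfolding cl_def by (simp add: divide_inverse mult.commute)
  ultimately show "cmod (cl z) \<le> B" by (simp add: pos_divide_le_eq)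
  assume "cmod z \<le> B"
  then have "max 1 (cmod z / B) = 1" using B by (simp add: max_absorb1)
  then show "cl z = z" unfolding cl_def by simp
qed

lemma integrable_indicator_Icc [simp]: "integrable lborel (indicat_real {a..b})" for a b :: real
  by (intro integrable_real_indicator) (auto simp: emeasure_lborel_Icc_eq)

lemma bounded_L1_compact_support:
  fixes k :: "real \<Rightarrow> complex"
  assumes k: "k \<in> borel_measurable borel" and b: "\<And>t. cmod (k t) \<le> B" and s: "\<And>t. \<bar>t\<bar> > N \<Longrightarrow> k t = 0"
  shows "bounded_L1 k"
proof -
  have B: "B \<ge> 0" using b[of 0] norm_ge_zero order_trans by blast
  have "integrable lborel (\<lambda>t. B * indicator {-N..N} t)" by simp
  moreover have "norm (k t) \<le> norm (B * indicator {-N..N} t)" for t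
    using B b[of t] s[of t] by (cases "\<bar>t\<bar> > N") (auto simp: abs_le_iff not_less)
  ultimately have "integrable lborel k"
    using k by (intro Bochner_Integration.integrable_bound[of lborel "\<lambda>t. B * indicator {-N..N} t" k]) auto
  then show ?thesis using k b unfolding bounded_L1_def by blast
qed

text \<open>Two dominated limits, each costing \<open>e/2\<close>. The trapezoidal cutoff
  \<open>chi m\<close> first makes the support compact. Then \<open>measurable_on\<close> supplies
  continuous functions converging to \<open>f\<close> off a negligible set; clamped and multiplied
  by \<open>chi m\<close>, they are dominated by a constant on a bounded interval.\<close>

lemma compact_support_approximation:
  assumes f: "bounded_L1 f" and e: "e > 0"
  obtains k B N where "continuous_on UNIV k" "\<And>t. cmod (k t) \<le> B" "\<And>t. \<bar>t\<bar> > N \<Longrightarrow> k t = 0" "l1 (\<lambda>t. f t - k t) < e"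
proof -
  obtain B0 where B0: "B0 \<ge> 0" "\<And>t. cmod (f t) \<le> B0" using bounded_L1_bound[OF f] by blast
  define B where "B = B0 + 1"
  have B: "B > 0" "\<And>t. cmod (f t) \<le> B" using B0 by (auto simp: B_def add_increasing2)
  have [measurable]: "f \<in> borel_measurable borel" using bounded_L1_measurable[OF f] .
  define chi where "chi m t = max 0 (min 1 (m - \<bar>t\<bar>))" for m t :: real
  have chi: "0 \<le> chi m t" "chi m t \<le> 1" "\<bar>t\<bar> > m \<Longrightarrow> chi m t = 0" for m t by (auto simp: chi_def)
  have chi_cont: "continuous_on UNIV (chi m)" for m unfolding chi_def[abs_def] by (intro continuous_intros)
  have [measurable]: "chi m \<in> borel_measurable borel" for m using chi_cont by (rule borel_measurable_continuous_onI)
  have "(\<lambda>m::nat. LINT t|lborel. cmod (f t - of_real (chi m t) * f t)) \<longlonglongrightarrow> (LINT t|(lborel :: real measure). (0::real))"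
  proof (rule integral_dominated_convergence[where w="\<lambda>t. cmod (f t)"])
    show "AE t in lborel. (\<lambda>m::nat. cmod (f t - of_real (chi m t) * f t)) \<longlonglongrightarrow> 0"
    proof (intro AE_I2)
      fix t
      have "eventually (\<lambda>m::nat. cmod (f t - of_real (chi m t) * f t) = 0) sequentially"
        using eventually_ge_at_top[of "nat \<lceil>\<bar>t\<bar> + 1\<rceil>"]
        by eventually_elim (simp add: chi_def min_def, linarith)
      then show "(\<lambda>m::nat. cmod (f t - of_real (chi m t) * f t)) \<longlonglongrightarrow> 0" by (rule tendsto_eventually)
    qed
    have "cmod (f t - of_real (chi m t) * f t) \<le> cmod (f t)" for m t
    proof -
      have "f t - of_real (chi m t) * f t = of_real (1 - chi m t) * f t" by (simp add: algebra_simps)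
      moreover have "\<bar>1 - chi m t\<bar> \<le> 1" using chi[of m t] by simp
      ultimately show ?thesis by (simp add: norm_mult mult_left_le_one_le del: of_real_diff)
    qed
    then show "AE t in lborel. norm (cmod (f t - of_real (chi m t) * f t)) \<le> cmod (f t)" for m::nat by simp
  qed (use bounded_L1_integrable_norm[OF f] in auto)
  then have "eventually (\<lambda>m::nat. (LINT t|lborel. cmod (f t - of_real (chi m t) * f t)) < e/2) sequentially"
    using e by (intro order_tendstoD) auto
  then obtain m :: nat where m: "l1 (\<lambda>t. f t - of_real (chi m t) * f t) < e/2"
    unfolding l1_def by (auto simp: eventually_sequentially)
  have "f \<in> borel_measurable (lebesgue_on UNIV)" by (simp add: lebesgue_on_UNIV_eq measurable_completion)
  then have "f measurable_on UNIV" by (subst measurable_on_iff_borel_measurable) auto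
  then obtain Z g where Z: "negligible Z" "\<And>n. continuous_on UNIV (g n)" "\<And>x. x \<notin> Z \<Longrightarrow> (\<lambda>n::nat. g n x) \<longlonglongrightarrow> f x"
    unfolding measurable_on_def by auto
  define cl where "cl z = z /\<^sub>R max 1 (cmod z / B)" for z :: complex
  note cl = clamp_complex[OF B(1), folded cl_def]
  have cg: "continuous_on UNIV (\<lambda>t. cl (g n t))" for n
    using continuous_on_compose2[OF cl(1) Z(2)] by auto
  have [measurable]: "(\<lambda>t. cl (g n t)) \<in> borel_measurable borel" for n
    using cg by (rule borel_measurable_continuous_onI)
  have ae: "AE t in lborel. t \<notin> Z"
    using AE_completion_iff[where M=lborel and P="\<lambda>t. t \<notin> Z"] Z(1) by (metis AE_not_in negligible_iff_null_sets)
  have "(\<lambda>n::nat. LINT t|lborel. cmod (of_real (chi m t) * f t - of_real (chi m t) * cl (g n t))) \<longlonglongrightarrow> (LINT t|(lborel :: real measure). (0::real))"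
  proof (rule integral_dominated_convergence[where w="\<lambda>t. 2 * B * indicator {-real m..real m} t"])
    show "AE t in lborel. (\<lambda>n. cmod (of_real (chi m t) * f t - of_real (chi m t) * cl (g n t))) \<longlonglongrightarrow> 0"
      using ae
    proof eventually_elim
      fix t assume "t \<notin> Z"
      then have "(\<lambda>n. cl (g n t)) \<longlonglongrightarrow> cl (f t)"
        using cl(1) Z(3) by (auto simp: continuous_on_eq_continuous_at intro: isCont_tendsto_compose)
      then have "(\<lambda>n. cmod (of_real (chi m t) * f t - of_real (chi m t) * cl (g n t))) \<longlonglongrightarrow> cmod (of_real (chi m t) * f t - of_real (chi m t) * f t)"
        using cl(3)[OF B(2)] by (intro tendsto_intros) simp
      then show "(\<lambda>n. cmod (of_real (chi m t) * f t - of_real (chi m t) * cl (g n t))) \<longlonglongrightarrow> 0" by simp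
    qed
    have "norm (cmod (of_real (chi m t) * f t - of_real (chi m t) * cl (g n t))) \<le> 2 * B * indicator {-real m..real m} t" for n t
    proof (cases "\<bar>t\<bar> > m")
      case True then show ?thesis using chi(3)[OF True] B by simp
    next
      case False
      have "cmod (f t - cl (g n t)) \<le> 2 * B" using norm_triangle_ineq4[of "f t" "cl (g n t)"] B(2)[of t] cl(2)[of "g n t"] by simp
      moreover have "cmod (of_real (chi m t) * f t - of_real (chi m t) * cl (g n t)) = chi m t * cmod (f t - cl (g n t))"
        using chi[of m t] by (simp add: right_diff_distrib[symmetric] norm_mult)
      moreover have "chi m t * cmod (f t - cl (g n t)) \<le> 1 * cmod (f t - cl (g n t))" using chi[of m t] by (intro mult_right_mono) auto
      ultimately have "cmod (of_real (chi m t) * f t - of_real (chi m t) * cl (g n t)) \<le> 2 * B" by linarith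
      moreover have "t \<in> {-real m..real m}" using False by auto
      ultimately show ?thesis by simp
    qed
    then show "AE t in lborel. norm (cmod (of_real (chi m t) * f t - of_real (chi m t) * cl (g n t))) \<le> 2 * B * indicator {-real m..real m} t" for n
      by simp
  qed (use B in auto)
  then have "eventually (\<lambda>n. (LINT t|lborel. cmod (of_real (chi m t) * f t - of_real (chi m t) * cl (g n t))) < e/2) sequentially"
    using e by (intro order_tendstoD) auto
  then obtain n where n: "l1 (\<lambda>t. of_real (chi m t) * f t - of_real (chi m t) * cl (g n t)) < e/2"
    unfolding l1_def by (auto simp: eventually_sequentially)
  define k where "k t = of_real (chi m t) * cl (g n t)" for t
  have kb: "cmod (k t) \<le> B" for t
  proof -
    have "cmod (k t) = chi m t * cmod (cl (g n t))" using chi[of m t] by (simp add: k_def norm_mult)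
    also have "\<dots> \<le> 1 * B" using chi[of m t] cl(2)[of "g n t"] B by (intro mult_mono) auto
    finally show ?thesis by simp
  qed
  have ks: "k t = 0" if "\<bar>t\<bar> > real m" for t using chi(3)[OF that] by (simp add: k_def)
  have kc: "continuous_on UNIV k" unfolding k_def[abs_def] by (intro continuous_intros chi_cont cg)
  have A: "bounded_L1 (\<lambda>t. of_real (chi m t) * f t)"
    by (rule bounded_L1_mult[OF f, of _ 1]) (use chi in auto)
  have K: "bounded_L1 k" by (rule bounded_L1_compact_support[OF borel_measurable_continuous_onI[OF kc] kb ks])
  have "l1 (\<lambda>t. f t - k t) < e"
    using l1_triangle[OF f A K] m n by (simp add: k_def)
  then show thesis using that[OF kc kb ks] by blast
qed

lemma compact_support_translation:
  assumes kc: "continuous_on UNIV k" and kb: "\<And>t. cmod (k t) \<le> B" and ks: "\<And>t. \<bar>t\<bar> > N \<Longrightarrow> k t = 0"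
    and h: "h \<longlonglongrightarrow> (0::real)"
  shows "(\<lambda>n::nat. l1 (\<lambda>t. k (t - h n) - k t)) \<longlonglongrightarrow> 0"
proof -
  have B: "B \<ge> 0" using kb[of 0] norm_ge_zero order_trans by blast
  have [measurable]: "k \<in> borel_measurable borel" using kc by (rule borel_measurable_continuous_onI)
  \<comment> \<open>All shifts are bounded by \<open>H\<close>, so every difference is supported in
    the single interval of radius \<open>N + H\<close>, which provides the dominating
    function.\<close>
  obtain H where H: "\<And>n. \<bar>h n\<bar> \<le> H" using convergent_imp_bounded[OF h] by (auto simp: bounded_iff)
  have "(\<lambda>n. LINT t|lborel. cmod (k (t - h n) - k t)) \<longlonglongrightarrow> (LINT t|(lborel :: real measure). (0::real))"
  proof (rule integral_dominated_convergence[where w="\<lambda>t. 2 * B * indicator {-(N + H)..N + H} t"])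
    show "AE t in lborel. (\<lambda>n. cmod (k (t - h n) - k t)) \<longlonglongrightarrow> 0"
    proof (intro AE_I2)
      fix t
      have "(\<lambda>n. t - h n) \<longlonglongrightarrow> t - 0" by (intro tendsto_intros h)
      then have "(\<lambda>n. k (t - h n)) \<longlonglongrightarrow> k t"
        using kc by (auto simp: continuous_on_eq_continuous_at intro: isCont_tendsto_compose)
      then have "(\<lambda>n. cmod (k (t - h n) - k t)) \<longlonglongrightarrow> cmod (k t - k t)" by (intro tendsto_intros)
      then show "(\<lambda>n. cmod (k (t - h n) - k t)) \<longlonglongrightarrow> 0" by simp
    qed
    have "norm (cmod (k (t - h n) - k t)) \<le> 2 * B * indicator {-(N + H)..N + H} t" for n t
    proof (cases "\<bar>t\<bar> > N + H")
      case True
      then have "\<bar>t\<bar> > N" "\<bar>t - h n\<bar> > N" using H[of n] by auto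
      then show ?thesis using ks B by simp
    next
      case False
      then have "t \<in> {-(N + H)..N + H}" by auto
      then show ?thesis using norm_triangle_ineq4[of "k (t - h n)" "k t"] kb[of t] kb[of "t - h n"] by simp
    qed
    then show "AE t in lborel. norm (cmod (k (t - h n) - k t)) \<le> 2 * B * indicator {-(N + H)..N + H} t" for n by simp
  qed (use B in auto)
  then show ?thesis by (simp add: l1_def)
qed

lemma l1_translation_continuous:
  assumes f: "bounded_L1 f" and h: "h \<longlonglongrightarrow> 0"
  shows "(\<lambda>n::nat. l1 (\<lambda>t. f (t - h n) - f t)) \<longlonglongrightarrow> 0"
proof (rule LIMSEQ_I)
  fix r :: real assume r: "r > 0"
  obtain k B N where k: "continuous_on UNIV k" "\<And>t. cmod (k t) \<le> B" "\<And>t. \<bar>t\<bar> > N \<Longrightarrow> k t = 0" "l1 (\<lambda>t. f t - k t) < r/3"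
    using compact_support_approximation[OF f, of "r/3"] r by auto
  have K: "bounded_L1 k" by (rule bounded_L1_compact_support[OF borel_measurable_continuous_onI[OF k(1)] k(2,3)])
  have "eventually (\<lambda>n. l1 (\<lambda>t. k (t - h n) - k t) < r/3) sequentially"
    using compact_support_translation[OF k(1-3) h] r by (intro order_tendstoD) auto
  then obtain n0 where n0: "\<And>n. n \<ge> n0 \<Longrightarrow> l1 (\<lambda>t. k (t - h n) - k t) < r/3" by (auto simp: eventually_sequentially)
  have "l1 (\<lambda>t. f (t - h n) - f t) < r" if "n \<ge> n0" for n
  proof -
    have "l1 (\<lambda>t. f (t - h n) - f t) \<le> l1 (\<lambda>t. f (t - h n) - k (t - h n)) + l1 (\<lambda>t. k (t - h n) - f t)"
      by (intro l1_triangle bounded_L1_translate f K)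
    also have "l1 (\<lambda>t. k (t - h n) - f t) \<le> l1 (\<lambda>t. k (t - h n) - k t) + l1 (\<lambda>t. k t - f t)"
      by (intro l1_triangle bounded_L1_translate f K)
    finally show ?thesis using n0[OF that] k(4) l1_translate[of "\<lambda>t. f t - k t" "h n"] l1_swap[of k f] by simp
  qed
  then show "\<exists>no. \<forall>n\<ge>no. norm (l1 (\<lambda>t. f (t - h n) - f t) - 0) < r" by auto
qed

text \<open>The increment of \<open>f \<odot> g\<close> is the convolution of \<open>g\<close> with
  a translation difference of \<open>f\<close>, which is small in \<open>L1\<close>. Continuity
  matters at \<open>0\<close>, where an autocorrelation takes the squared \<open>L2\<close> norm as
  its value.\<close>

lemma conv_continuous:
  assumes f: "bounded_L1 f" and g: "bounded_L1 g"
  shows "isCont (f \<odot> g) t"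
  unfolding continuous_at_sequentially
proof (intro allI impI)
  fix x :: "nat \<Rightarrow> real" assume x: "x \<longlonglongrightarrow> t"
  obtain B where B: "B \<ge> 0" "\<And>t. cmod (g t) \<le> B" using bounded_L1_bound[OF g] by blast
  have "(\<lambda>n. t - x n) \<longlonglongrightarrow> t - t" by (intro tendsto_intros x)
  then have L: "(\<lambda>n. l1 (\<lambda>s. f (s - (t - x n)) - f s)) \<longlonglongrightarrow> 0" by (intro l1_translation_continuous f) simp
  have bound: "norm ((f \<odot> g) (x n) - (f \<odot> g) t) \<le> l1 (\<lambda>s. f (s - (t - x n)) - f s) * B" for n
  proof -
    have "t - s - (t - x n) = x n - s" for s by simp
    then have "(f \<odot> g) (x n) - (f \<odot> g) t = ((\<lambda>s. f (s - (t - x n)) - f s) \<odot> g) t"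
      using conv_integrable[OF f g, of "x n"] conv_integrable[OF f g, of t]
      by (simp add: conv_def left_diff_distrib)
    moreover have "cmod (((\<lambda>s. f (s - (t - x n)) - f s) \<odot> g) t) \<le> l1 (\<lambda>s. f (s - (t - x n)) - f s) * B"
      by (intro norm_conv_le_l1 bounded_L1_diff bounded_L1_translate f g) (auto intro!: mult_left_mono B)
    ultimately show ?thesis by simp
  qed
  have "(\<lambda>n. l1 (\<lambda>s. f (s - (t - x n)) - f s) * B) \<longlonglongrightarrow> 0" using tendsto_mult_left_zero[OF L, of B] by simp
  then have "(\<lambda>n. (f \<odot> g) (x n) - (f \<odot> g) t) \<longlonglongrightarrow> 0"
    by (rule Lim_null_comparison[rotated]) (simp add: bound)
  then show "((f \<odot> g) \<circ> x) \<longlonglongrightarrow> (f \<odot> g) t" unfolding o_def by (rule LIM_zero_cancel)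
qed

section \<open>Decay and continuity of the Fourier transform\<close>

lemma norm_fourier_le: "cmod (fourier f w) \<le> l1 f"
  unfolding fourier_def l1_def by (rule order_trans[OF integral_norm_bound]) (simp add: norm_mult)

text \<open>A shift by \<open>pi / w\<close> multiplies the transform at \<open>w\<close> by
  \<open>-1\<close>, so the transform of the difference is \<open>-2\<close> times that of
  \<open>f\<close>. Continuity of translation thereby turns into decay at infinity.\<close>

lemma norm_fourier_le_translation:
  assumes f: "bounded_L1 f" and w: "w \<noteq> 0"
  shows "cmod (fourier f w) \<le> l1 (\<lambda>t. f (t - pi / w) - f t)"
proof -
  have "fourier (\<lambda>t. f (t - pi / w)) w = (LINT t|lborel. f t * cis (- (w * (t + pi / w))))"
    unfolding fourier_def using integral_translate[of "\<lambda>t. f t * cis (- (w * (t + pi / w)))" "pi / w"] by simp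
  also have "\<dots> = (LINT t|lborel. - (f t * cis (- (w * t))))"
    using w by (intro Bochner_Integration.integral_cong refl)
      (simp add: distrib_left cis_divide[symmetric])
  also have "\<dots> = - fourier f w" by (simp add: fourier_def)
  finally have E: "fourier (\<lambda>t. f (t - pi / w)) w = - fourier f w" .
  have "fourier (\<lambda>t. f (t - pi / w) - f t) w + fourier f w = fourier (\<lambda>t. f (t - pi / w)) w"
    by (subst fourier_add[symmetric]) (auto intro!: bounded_L1_diff bounded_L1_translate f)
  then have "2 * fourier f w = - fourier (\<lambda>t. f (t - pi / w) - f t) w" by (simp add: E algebra_simps eq_neg_iff_add_eq_0)
  then have "2 * cmod (fourier f w) = cmod (fourier (\<lambda>t. f (t - pi / w) - f t) w)"
    by (metis norm_minus_cancel norm_mult norm_numeral)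
  then show ?thesis using norm_fourier_le[of "\<lambda>t. f (t - pi / w) - f t" w] norm_ge_zero[of "fourier f w"] by linarith
qed

lemma Riemann_Lebesgue:
  assumes f: "bounded_L1 f"
  shows "(fourier f \<longlongrightarrow> 0) at_infinity"
proof -
  have "((\<lambda>h. l1 (\<lambda>t. f (t - h) - f t)) \<longlongrightarrow> 0) (at 0)"
    unfolding tendsto_at_iff_sequentially using l1_translation_continuous[OF f] by (auto simp: o_def)
  moreover have "((\<lambda>w::real. pi / w) \<longlongrightarrow> 0) at_infinity"
    using tendsto_mult_right_zero[OF tendsto_inverse_0, of pi] by (simp add: divide_inverse)
  then have "filterlim (\<lambda>w::real. pi / w) (at 0) at_infinity"
    unfolding filterlim_at using eventually_not_equal_at_infinity[of "0::real"] by auto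
  ultimately have "((\<lambda>w. l1 (\<lambda>t. f (t - pi / w) - f t)) \<longlongrightarrow> 0) at_infinity"
    by (rule filterlim_compose)
  then show ?thesis
    by (rule Lim_null_comparison[rotated])
       (use eventually_not_equal_at_infinity[of "0::real"] norm_fourier_le_translation[OF f] in \<open>auto elim!: eventually_mono\<close>)
qed

lemma fourier_continuous:
  assumes f: "bounded_L1 f" shows "continuous_on UNIV (fourier f)"
  unfolding continuous_on_eq_continuous_at[OF open_UNIV] continuous_at_sequentially
proof (intro ballI allI impI)
  fix w :: real and x :: "nat \<Rightarrow> real" assume x: "x \<longlonglongrightarrow> w"
  have [measurable]: "f \<in> borel_measurable borel" using bounded_L1_measurable[OF f] .
  show "(fourier f \<circ> x) \<longlonglongrightarrow> fourier f w"
    unfolding fourier_def o_def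
  proof (rule integral_dominated_convergence[where w="\<lambda>t. cmod (f t)"])
    show "AE t in lborel. (\<lambda>n. f t * cis (- (x n * t))) \<longlonglongrightarrow> f t * cis (- (w * t))"
      unfolding cis_conv_exp by (intro AE_I2 tendsto_intros x)
  qed (use bounded_L1_integrable_norm[OF f] in \<open>auto simp: norm_mult cis_conv_exp\<close>)
qed

lemma one_minus_fourier_bounded_below:
  assumes f: "bounded_L1 f" and nz: "\<And>w. fourier f w \<noteq> 1"
  obtains m where "m > 0" "\<And>w. m \<le> cmod (1 - fourier f w)"
proof -
  have "eventually (\<lambda>w. cmod (fourier f w) < 1/2) at_infinity"
    using tendsto_norm_zero[OF Riemann_Lebesgue[OF f]] by (intro order_tendstoD) auto
  then obtain N where N: "\<And>w. \<bar>w\<bar> \<ge> N \<Longrightarrow> cmod (fourier f w) < 1/2"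
    by (auto simp: eventually_at_infinity)
  \<comment> \<open>The absolute value keeps the interval nonempty even for negative
    \<open>N\<close>. Inside it compactness gives the bound, outside it the transform is below
    \<open>1/2\<close>.\<close>
  have "continuous_on {-\<bar>N\<bar>..\<bar>N\<bar>} (\<lambda>w. cmod (1 - fourier f w))"
    by (intro continuous_intros continuous_on_subset[OF fourier_continuous[OF f]]) auto
  then obtain w0 where w0: "\<And>w. w \<in> {-\<bar>N\<bar>..\<bar>N\<bar>} \<Longrightarrow> cmod (1 - fourier f w0) \<le> cmod (1 - fourier f w)"
    using continuous_attains_inf[of "{-\<bar>N\<bar>..\<bar>N\<bar>}" "\<lambda>w. cmod (1 - fourier f w)"]
    by (metis compact_Icc abs_ge_zero atLeastAtMost_iff empty_iff neg_le_0_iff_le order_trans)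
  show thesis
  proof (rule that[of "min (1/2) (cmod (1 - fourier f w0))"])
    show "0 < min (1/2) (cmod (1 - fourier f w0))" using nz[of w0] by simp
    fix w show "min (1/2) (cmod (1 - fourier f w0)) \<le> cmod (1 - fourier f w)"
    proof (cases "\<bar>w\<bar> \<ge> N")
      case True
      then have "cmod (1 - fourier f w) \<ge> 1 - 1/2" using N[OF True] norm_triangle_ineq2[of 1 "fourier f w"] by simp
      then show ?thesis by simp
    next
      case False
      then have "w \<in> {-\<bar>N\<bar>..\<bar>N\<bar>}" by auto
      then show ?thesis using w0[of w] by simp
    qed
  qed
qed

section \<open>Gaussian averages of the transform and comparison of \<open>L2\<close> norms\<close>

lemma integrable_std_normal_density: "integrable lborel std_normal_density"
  using integrable_normal_moment[of 1 0 0] by (simp add: std_normal_density_def)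

lemma integral_std_normal_cis: "(LINT x|lborel. std_normal_density x *\<^sub>R cis (a * x)) = of_real (exp (- a\<^sup>2 / 2))"
proof -
  have "char std_normal_distribution a = (LINT x|lborel. std_normal_density x *\<^sub>R cis (a * x))"
    unfolding char_def by (subst integral_density) (auto simp: cis_conv_exp)
  then show ?thesis by (simp add: char_std_normal_distribution)
qed

text \<open>Fubini, with the characteristic function of the normal distribution evaluated in the
  inner integral: a wide Gaussian on the frequency side becomes a narrow one on the time
  side.\<close>

lemma gaussian_mean_fourier:
  assumes c: "bounded_L1 c"
  shows "(LINT x|lborel. std_normal_density x *\<^sub>R fourier c (N * x)) = (LINT h|lborel. c h * of_real (exp (- (N * h)\<^sup>2 / 2)))"
proof -
  have [measurable]: "c \<in> borel_measurable borel" using bounded_L1_measurable[OF c] .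
  have P: "integrable (lborel \<Otimes>\<^sub>M lborel) (\<lambda>(h,x). c h * (std_normal_density x *\<^sub>R cis (- (N * x * h))))"
  proof (rule lborel_pair.Fubini_integrable)
    show "(\<lambda>(h,x). c h * (std_normal_density x *\<^sub>R cis (- (N * x * h)))) \<in> borel_measurable (lborel \<Otimes>\<^sub>M lborel)"
      unfolding cis_conv_exp by measurable
    show "integrable lborel (\<lambda>h. LINT x|lborel. norm (case (h,x) of (h,x) \<Rightarrow> c h * (std_normal_density x *\<^sub>R cis (- (N * x * h)))))"
      using bounded_L1_integrable_norm[OF c] by (simp add: norm_mult)
    show "AE h in lborel. integrable lborel (\<lambda>x. case (h,x) of (h,x) \<Rightarrow> c h * (std_normal_density x *\<^sub>R cis (- (N * x * h))))"
      unfolding prod.case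
      by (intro AE_I2 integrable_mult_right, rule Bochner_Integration.integrable_bound[OF integrable_std_normal_density])
         (auto simp: cis_conv_exp)
  qed
  have "(LINT x|lborel. std_normal_density x *\<^sub>R fourier c (N * x)) = (LINT x|lborel. LINT h|lborel. c h * (std_normal_density x *\<^sub>R cis (- (N * x * h))))"
    unfolding fourier_def by (simp add: scaleR_conv_of_real mult_ac flip: integral_mult_right_zero)
  also have "\<dots> = (LINT h|lborel. LINT x|lborel. c h * (std_normal_density x *\<^sub>R cis (- (N * x * h))))"
    by (rule lborel_pair.Fubini_integral[OF P])
  also have "\<dots> = (LINT h|lborel. c h * of_real (exp (- (N * h)\<^sup>2 / 2)))"
  proof (intro Bochner_Integration.integral_cong refl)
    fix h
    show "(LINT x|lborel. c h * (std_normal_density x *\<^sub>R cis (- (N * x * h)))) = c h * of_real (exp (- (N * h)\<^sup>2 / 2))"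
      using integral_std_normal_cis[of "- (N * h)"] unfolding integral_mult_right_zero by (simp add: mult_ac)
  qed
  finally show ?thesis .
qed

text \<open>Fourier inversion at the origin in Gaussian summation. After the rescaling
  \<open>y = N h\<close> the average tests \<open>c (y / N)\<close> against a fixed Gaussian, and
  boundedness of \<open>c\<close> gives the domination. The factor \<open>sqrt (2 * pi)\<close> is
  the mass of \<open>exp (- y^2 / 2)\<close>.\<close>

lemma gaussian_mean_limit:
  assumes c: "bounded_L1 c" and cont: "isCont c 0"
  shows "(\<lambda>n. of_nat (Suc n) * (LINT x|lborel. std_normal_density x *\<^sub>R fourier c (real (Suc n) * x))) \<longlonglongrightarrow> of_real (sqrt (2 * pi)) * c 0"
proof -
  have [measurable]: "c \<in> borel_measurable borel" using bounded_L1_measurable[OF c] .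
  obtain B where B: "B \<ge> 0" "\<And>t. cmod (c t) \<le> B" using bounded_L1_bound[OF c] by blast
  have "(\<lambda>n. LINT y|lborel. std_normal_density y *\<^sub>R c (y / real (Suc n))) \<longlonglongrightarrow> (LINT y|lborel. std_normal_density y *\<^sub>R c 0)"
  proof (rule integral_dominated_convergence[where w="\<lambda>y. std_normal_density y * B"])
    show "AE y in lborel. (\<lambda>n. std_normal_density y *\<^sub>R c (y / real (Suc n))) \<longlonglongrightarrow> std_normal_density y *\<^sub>R c 0"
    proof (intro AE_I2 tendsto_intros isCont_tendsto_compose[OF cont])
      fix y :: real
      show "(\<lambda>n. y / real (Suc n)) \<longlonglongrightarrow> 0"
        using tendsto_mult_right_zero[OF LIMSEQ_inverse_real_of_nat, of y] by (simp add: divide_inverse)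
    qed
  qed (use B integrable_std_normal_density in \<open>auto intro!: mult_left_mono\<close>)
  then have L: "(\<lambda>n. of_real (sqrt (2 * pi)) * (LINT y|lborel. std_normal_density y *\<^sub>R c (y / real (Suc n)))) \<longlonglongrightarrow> of_real (sqrt (2 * pi)) * c 0"
    by (intro tendsto_intros) (simp add: integrable_std_normal_density)
  have "of_nat (Suc n) * (LINT x|lborel. std_normal_density x *\<^sub>R fourier c (real (Suc n) * x))
      = of_real (sqrt (2 * pi)) * (LINT y|lborel. std_normal_density y *\<^sub>R c (y / real (Suc n)))" for n
  proof -
    define N where "N = real (Suc n)"
    have N: "N > 0" by (simp add: N_def)
    have "(LINT y|lborel. std_normal_density y *\<^sub>R c (y / N)) = N *\<^sub>R (LINT h|lborel. std_normal_density (N * h) *\<^sub>R c h)"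
      using lborel_integral_real_affine[of N "\<lambda>y. std_normal_density y *\<^sub>R c (y / N)" 0] N by simp
    also have "(LINT h|lborel. std_normal_density (N * h) *\<^sub>R c h) = (LINT h|lborel. of_real (1 / sqrt (2 * pi)) * (c h * of_real (exp (- (N * h)\<^sup>2 / 2))))"
      by (intro Bochner_Integration.integral_cong refl) (simp add: std_normal_density_def scaleR_conv_of_real mult_ac)
    also have "\<dots> = of_real (1 / sqrt (2 * pi)) * (LINT x|lborel. std_normal_density x *\<^sub>R fourier c (N * x))"
      by (simp only: gaussian_mean_fourier[OF c] integral_mult_right_zero)
    finally show ?thesis unfolding N_def by (simp add: scaleR_conv_of_real)
  qed
  with L show ?thesis by simp
qed

text \<open>\<open>gaussian_mean_limit\<close> is applied to the autocorrelation
  \<open>f \<odot> fr\<close> with \<open>fr t = cnj (f (- t))\<close>: its transform is the squared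
  modulus of \<open>fourier f\<close>, and its value at \<open>0\<close> is the squared
  \<open>L2\<close> norm of \<open>f\<close>.\<close>

lemma Plancherel_limit:
  assumes f: "bounded_L1 f"
  shows "(\<lambda>n. real (Suc n) * (LINT x|lborel. std_normal_density x * (cmod (fourier f (real (Suc n) * x)))\<^sup>2))
    \<longlonglongrightarrow> sqrt (2 * pi) * (LINT t|lborel. (cmod (f t))\<^sup>2)"
proof -
  define fr where "fr t = cnj (f (0 - t))" for t
  have [measurable]: "f \<in> borel_measurable borel" using bounded_L1_measurable[OF f] .
  have "fr \<in> borel_measurable borel" unfolding fr_def[abs_def] by (rule measurable_compose[OF _ borel_measurable_continuous_onI]) (auto intro: continuous_intros)
  then have fr: "bounded_L1 fr" using bounded_L1_reflect[OF f, of 0] unfolding bounded_L1_def fr_def by auto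
  note c = bounded_L1_conv[OF f fr]
  have "fourier fr w = cnj (fourier f w)" for w
  proof -
    have "fourier fr w = (LINT t|lborel. cnj (f (0 - t) * cis (- (w * (0 - t)))))"
      by (simp add: fourier_def fr_def cis_cnj)
    also have "\<dots> = cnj (LINT t|lborel. f (0 - t) * cis (- (w * (0 - t))))" by (rule Bochner_Integration.integral_cnj)
    also have "\<dots> = cnj (fourier f w)"
      using integral_reflect[of "\<lambda>t. f t * cis (- (w * t))" 0] by (simp add: fourier_def)
    finally show ?thesis .
  qed
  then have F: "fourier (f \<odot> fr) w = of_real ((cmod (fourier f w))\<^sup>2)" for w
    by (simp only: fourier_conv[OF f fr] complex_norm_square)
  have "(f \<odot> fr) 0 = (LINT s|lborel. of_real ((cmod (f (0 - s)))\<^sup>2))"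
    unfolding conv_def fr_def by (simp only: complex_norm_square)
  also have "\<dots> = of_real (LINT s|lborel. (cmod (f (0 - s)))\<^sup>2)"
    by (rule integral_complex_of_real)
  also have "\<dots> = of_real (LINT s|lborel. (cmod (f s))\<^sup>2)"
    using integral_reflect[of "\<lambda>s. (cmod (f s))\<^sup>2" 0] by simp
  finally have C0: "(f \<odot> fr) 0 = of_real (LINT s|lborel. (cmod (f s))\<^sup>2)" .
  have E: "(LINT x|lborel. std_normal_density x *\<^sub>R fourier (f \<odot> fr) (a * x)) = of_real (LINT x|lborel. std_normal_density x * (cmod (fourier f (a * x)))\<^sup>2)" for a
    unfolding F scaleR_conv_of_real of_real_mult[symmetric] by (rule integral_complex_of_real)
  have "(\<lambda>n. Re (of_nat (Suc n) * (LINT x|lborel. std_normal_density x *\<^sub>R fourier (f \<odot> fr) (real (Suc n) * x)))) \<longlonglongrightarrow> Re (of_real (sqrt (2 * pi)) * (f \<odot> fr) 0)"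
    by (intro tendsto_Re gaussian_mean_limit c conv_continuous f fr)
  then show ?thesis unfolding E C0 by (simp del: of_nat_Suc)
qed

text \<open>The comparison holds for every Gaussian average and survives the limit. Since each
  average has an integrable weight and a bounded transform, square integrability of the transforms
  never has to be discussed.\<close>

lemma l2_le_of_fourier_le:
  assumes u: "bounded_L1 u" and v: "bounded_L1 v" and le: "\<And>w. cmod (fourier u w) \<le> c * cmod (fourier v w)"
  shows "(LINT t|lborel. (cmod (u t))\<^sup>2) \<le> c\<^sup>2 * (LINT t|lborel. (cmod (v t))\<^sup>2)"
proof -
  have I: "integrable lborel (\<lambda>x. std_normal_density x * (cmod (fourier f (a * x)))\<^sup>2)" if f: "bounded_L1 f" for f a
  proof (rule Bochner_Integration.integrable_bound[OF integrable_mult_left[OF integrable_std_normal_density, of "(l1 f)\<^sup>2"]])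
    have [measurable]: "fourier f \<in> borel_measurable borel" using fourier_continuous[OF f] by (rule borel_measurable_continuous_onI)
    show "(\<lambda>x. std_normal_density x * (cmod (fourier f (a * x)))\<^sup>2) \<in> borel_measurable lborel" by measurable
    show "AE x in lborel. norm (std_normal_density x * (cmod (fourier f (a * x)))\<^sup>2) \<le> norm (std_normal_density x * (l1 f)\<^sup>2)"
      by (auto simp: abs_mult intro!: mult_left_mono power_mono norm_fourier_le)
  qed
  have "sqrt (2 * pi) * (LINT t|lborel. (cmod (u t))\<^sup>2) \<le> c\<^sup>2 * (sqrt (2 * pi) * (LINT t|lborel. (cmod (v t))\<^sup>2))"
  proof (rule LIMSEQ_le[OF Plancherel_limit[OF u] tendsto_mult[OF tendsto_const Plancherel_limit[OF v]]], intro exI allI impI)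
    fix n :: nat
    have "(LINT x|lborel. std_normal_density x * (cmod (fourier u (real (Suc n) * x)))\<^sup>2)
        \<le> (LINT x|lborel. c\<^sup>2 * (std_normal_density x * (cmod (fourier v (real (Suc n) * x)))\<^sup>2))"
    proof (intro integral_mono integrable_mult_right I u v)
      fix x
      have "(cmod (fourier u (real (Suc n) * x)))\<^sup>2 \<le> (c * cmod (fourier v (real (Suc n) * x)))\<^sup>2"
        by (intro power_mono le) auto
      then show "std_normal_density x * (cmod (fourier u (real (Suc n) * x)))\<^sup>2 \<le> c\<^sup>2 * (std_normal_density x * (cmod (fourier v (real (Suc n) * x)))\<^sup>2)"
        using mult_left_mono[of _ _ "std_normal_density x"] by (fastforce simp: power_mult_distrib mult_ac)
    qed
    then have "real (Suc n) * (LINT x|lborel. std_normal_density x * (cmod (fourier u (real (Suc n) * x)))\<^sup>2)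
      \<le> real (Suc n) * (c\<^sup>2 * (LINT x|lborel. std_normal_density x * (cmod (fourier v (real (Suc n) * x)))\<^sup>2))"
      by (intro mult_left_mono) auto
    then show "real (Suc n) * (LINT x|lborel. std_normal_density x * (cmod (fourier u (real (Suc n) * x)))\<^sup>2)
      \<le> c\<^sup>2 * (real (Suc n) * (LINT x|lborel. std_normal_density x * (cmod (fourier v (real (Suc n) * x)))\<^sup>2))"
      by (simp only: mult_ac)
  qed
  then have "sqrt (2 * pi) * (LINT t|lborel. (cmod (u t))\<^sup>2) \<le> sqrt (2 * pi) * (c\<^sup>2 * (LINT t|lborel. (cmod (v t))\<^sup>2))"
    by (simp only: mult_ac)
  then show ?thesis by (subst (asm) mult_le_cancel_left_pos) auto
qed

subsection \<open>Resolvents\<close>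

text \<open>Extending functions by zero turns the Volterra integral over \<open>[0,t]\<close> into a
  convolution on the whole line, where translation invariance and the Fourier transform are
  available.\<close>

definition causal :: "(real \<Rightarrow> complex) \<Rightarrow> bool" where
  "causal f \<longleftrightarrow> (\<forall>t<0. f t = 0)"

text \<open>With the Dirac mass \<delta> as unit of convolution, the equation says that
  \<open>\<delta> + K\<close> is inverse to \<open>\<delta> - g\<close>. The identities below are
  computations with such factors, written out without \<delta>.\<close>

definition resolvent :: "(real \<Rightarrow> complex) \<Rightarrow> (real \<Rightarrow> complex) \<Rightarrow> bool" where
  "resolvent g K \<longleftrightarrow> bounded_L1 K \<and> causal K \<and> (\<forall>t. K t = g t + (g \<odot> K) t)"

lemma causal_conv:
  assumes "causal f" "causal g" shows "causal (f \<odot> g)"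
  unfolding causal_def
proof (intro allI impI)
  fix t :: real assume t: "t < 0"
  have "(\<lambda>s. f (t - s) * g s) = (\<lambda>s. 0)"
  proof
    fix s show "f (t - s) * g s = 0"
      using assms t by (cases "s < 0") (auto simp: causal_def)
  qed
  then show "(f \<odot> g) t = 0" by (simp add: conv_def)
qed

text \<open>\<open>K\<close> is the sum of the convolution powers of \<open>H\<close>. Two geometric
  bounds are carried along: the one for the supremum makes the series converge at every point, the
  one for \<open>l1\<close> makes its sum integrable.\<close>

lemma resolvent_neumann:
  assumes H: "bounded_L1 H" and cH: "causal H" and q: "l1 H < 1"
  shows "\<exists>L. resolvent H L"
proof -
  obtain B where B: "B \<ge> 0" "\<And>t. cmod (H t) \<le> B" using bounded_L1_bound[OF H] by blast
  define q where "q = l1 H"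
  have q0: "0 \<le> q" "q < 1" using q by (auto simp: q_def)
  \<comment> \<open>\<open>P k\<close> is the convolution power with \<open>k + 1\<close> factors,
    hence \<open>q ^ Suc k\<close> in the bound for \<open>l1\<close> but only \<open>q ^ k\<close>
    beside the supremum bound \<open>B\<close> of one factor.\<close>
  define P where "P k = ((\<lambda>f. H \<odot> f) ^^ k) H" for k
  have P0: "P 0 = H" and PS: "P (Suc k) = H \<odot> P k" for k by (auto simp: P_def)
  have P: "bounded_L1 (P k)" for k by (induction k) (auto simp: P0 PS H bounded_L1_conv)
  have [measurable]: "P k \<in> borel_measurable borel" for k using bounded_L1_measurable[OF P] .
  have [measurable]: "H \<in> borel_measurable borel" using bounded_L1_measurable[OF H] .
  have cP: "causal (P k)" for k by (induction k) (auto simp: P0 PS cH causal_conv)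
  have Pb: "cmod (P k t) \<le> q ^ k * B" for k t
  proof (induction k arbitrary: t)
    case (Suc k)
    have "cmod ((H \<odot> P k) t) \<le> l1 H * (q ^ k * B)"
      by (intro norm_conv_le_l1 H P AE_I2 mult_left_mono Suc) auto
    then show ?case by (simp add: PS q_def mult_ac)
  qed (use B P0 in auto)
  have Pl: "l1 (P k) \<le> q ^ Suc k" for k
  proof (induction k)
    case (Suc k)
    have "l1 (P (Suc k)) \<le> l1 H * l1 (P k)" unfolding PS by (intro l1_conv H P)
    also have "\<dots> \<le> q * q ^ Suc k" unfolding q_def[symmetric] using Suc q0 by (intro mult_left_mono)
    finally show ?case by simp
  qed (simp add: P0 q_def)
  have geo: "summable (\<lambda>k. q ^ k * B)" using q0 by (intro summable_mult2 summable_geometric) auto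
  have sP: "summable (\<lambda>k. cmod (P k t))" for t
    by (rule summable_comparison_test'[OF geo, of 0]) (use Pb in auto)
  have sL: "summable (\<lambda>k. l1 (P k))"
    by (rule summable_comparison_test'[of "\<lambda>k. q ^ Suc k" 0]) (use Pl q0 in \<open>auto intro!: summable_mult summable_geometric\<close>)
  define L where "L t = (\<Sum>k. P k t)" for t
  have "integrable lborel (\<lambda>t. \<Sum>k. P k t)"
    by (rule integrable_suminf) (use P sP sL in \<open>auto simp: bounded_L1_integrable l1_def\<close>)
  moreover have "cmod (L t) \<le> (\<Sum>k. q ^ k * B)" for t
    unfolding L_def by (rule order_trans[OF summable_norm[OF sP]]) (intro suminf_le Pb sP geo)
  moreover have "L \<in> borel_measurable borel" unfolding L_def[abs_def] by measurable
  ultimately have bL: "bounded_L1 L" unfolding bounded_L1_def L_def[abs_def] by blast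
  have cL: "causal L" using cP unfolding causal_def L_def by simp
  have "L t = H t + (H \<odot> L) t" for t
  proof -
    have "(H \<odot> L) t = (LINT s|lborel. (\<Sum>k. H (t - s) * P k s))"
      unfolding conv_def L_def using summable_norm_cancel[OF sP] by (simp add: suminf_mult)
    also have "\<dots> = (\<Sum>k. (LINT s|lborel. H (t - s) * P k s))"
    proof (rule integral_suminf)
      show "integrable lborel (\<lambda>s. H (t - s) * P k s)" for k by (rule conv_integrable[OF H P])
      show "AE s in lborel. summable (\<lambda>k. norm (H (t - s) * P k s))"
        using sP by (auto simp: norm_mult intro!: summable_mult)
      show "summable (\<lambda>k. LINT s|lborel. norm (H (t - s) * P k s))"
      proof (rule summable_comparison_test'[OF summable_mult[OF sL, of B], of 0])
        fix k
        have "(LINT s|lborel. norm (H (t - s) * P k s)) \<le> (LINT s|lborel. B * cmod (P k s))"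
          using conv_integrable[OF H P, of t k, THEN integrable_norm] bounded_L1_integrable_norm[OF P, of k] B
          by (intro integral_mono) (auto simp: norm_mult intro!: mult_right_mono)
        then show "norm (LINT s|lborel. norm (H (t - s) * P k s)) \<le> B * l1 (P k)" by (simp add: l1_def)
      qed
    qed
    also have "\<dots> = (\<Sum>k. P (Suc k) t)" by (simp add: PS conv_def)
    also have "\<dots> = L t - H t"
      unfolding L_def using suminf_split_head[OF summable_norm_cancel[OF sP]] by (simp add: P0)
    finally show ?thesis by simp
  qed
  then show ?thesis using bL cL unfolding resolvent_def by blast
qed

lemma resolvent_conv:
  assumes g: "bounded_L1 g" and K: "resolvent g K" and r: "bounded_L1 r"
  shows "(K \<odot> r) t = (g \<odot> r) t + (g \<odot> (K \<odot> r)) t"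
proof -
  have bK: "bounded_L1 K" and E: "K = (\<lambda>t. g t + (g \<odot> K) t)" using K unfolding resolvent_def by auto
  have "K \<odot> r = (\<lambda>t. g t + (g \<odot> K) t) \<odot> r" using E by simp
  also have "\<dots> = (\<lambda>t. (g \<odot> r) t + ((g \<odot> K) \<odot> r) t)" by (intro conv_add_left r g bounded_L1_conv bK)
  finally show ?thesis unfolding conv_assoc[OF g bK r] by (rule fun_cong)
qed

text \<open>Applying \<open>\<delta> + K\<close> to \<open>y = r - g \<odot> r\<close> recovers
  \<open>r = y + K \<odot> y\<close>. The cancellation needs
  \<open>K \<odot> g = g \<odot> K\<close>, which commutativity provides.\<close>

lemma resolvent_solves:
  assumes g: "bounded_L1 g" and K: "resolvent g K" and r: "bounded_L1 r"
  shows "(g \<odot> r) t = (K \<odot> (\<lambda>s. r s - (g \<odot> r) s)) t"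
proof -
  have bK: "bounded_L1 K" using K unfolding resolvent_def by auto
  have "(K \<odot> (\<lambda>s. r s - (g \<odot> r) s)) t = (K \<odot> r) t - (K \<odot> (g \<odot> r)) t"
    by (simp add: conv_diff_right bounded_L1_conv bK g r)
  also have "K \<odot> (g \<odot> r) = g \<odot> (K \<odot> r)"
    by (metis conv_assoc conv_commute bK g r)
  finally show ?thesis using resolvent_conv[OF assms, of t] by simp
qed

text \<open>With \<open>E = g' - g\<close> there is the factorization
  \<open>\<delta> - g' = (\<delta> - g) \<odot> (\<delta> - H)\<close>, where
  \<open>H = E + K \<odot> E\<close>. The smallness condition makes \<open>l1 H < 1\<close>, so the
  second factor has a Neumann inverse \<open>\<delta> + L\<close>, and expanding
  \<open>(\<delta> + L) \<odot> (\<delta> + K)\<close> gives the formula for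
  \<open>K'\<close>.\<close>

lemma resolvent_perturb:
  assumes g: "bounded_L1 g" and g': "bounded_L1 g'" and c: "causal g" "causal g'" and K: "resolvent g K"
    and small: "(1 + l1 K) * l1 (\<lambda>t. g' t - g t) < 1"
  shows "\<exists>K'. resolvent g' K'"
proof -
  have bK: "bounded_L1 K" and cK: "causal K" and E: "\<And>t. K t = g t + (g \<odot> K) t" using K unfolding resolvent_def by auto
  define E where "E t = g' t - g t" for t
  have bE: "bounded_L1 E" unfolding E_def[abs_def] by (intro bounded_L1_diff g g')
  have cE: "causal E" using c by (auto simp: E_def causal_def)
  define H where "H t = E t + (K \<odot> E) t" for t
  have bH: "bounded_L1 H" unfolding H_def[abs_def] by (intro bounded_L1_add bounded_L1_conv bE bK)
  have cH: "causal H" using cE causal_conv[OF cK cE] by (auto simp: H_def causal_def)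
  have "l1 H \<le> l1 E + l1 K * l1 E"
    unfolding H_def[abs_def] using l1_add[OF bE bounded_L1_conv[OF bK bE]] l1_conv[OF bK bE] by linarith
  also have "\<dots> < 1" using small by (simp add: E_def[abs_def] algebra_simps)
  finally obtain L where "resolvent H L" using resolvent_neumann[OF bH cH] by blast
  then have bL: "bounded_L1 L" and cL: "causal L" and L: "\<And>t. L t = H t + (H \<odot> L) t" unfolding resolvent_def by auto
  define K' where "K' t = (L t + K t) + (L \<odot> K) t" for t
  have bK': "bounded_L1 K'" unfolding K'_def[abs_def] by (intro bounded_L1_add bounded_L1_conv bL bK)
  have cK': "causal K'" using cL cK causal_conv[OF cL cK] by (auto simp: K'_def causal_def)
  have "K' t = g' t + (g' \<odot> K') t" for t
  proof -
    have g'_eq: "g' = (\<lambda>t. g t + E t)" by (auto simp: E_def)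
    have 1: "(g' \<odot> K') t = (g \<odot> K') t + (E \<odot> K') t"
      unfolding g'_eq by (simp add: conv_add_left g bE bK')
    have "(f \<odot> K') t = (f \<odot> L) t + (f \<odot> K) t + (f \<odot> (L \<odot> K)) t" if f: "bounded_L1 f" for f
      unfolding K'_def[abs_def] by (simp add: conv_add_right f bounded_L1_add bounded_L1_conv bL bK)
    note 2 = this[OF g] this[OF bE]
    have "g \<odot> (L \<odot> K) = g \<odot> (K \<odot> L)" by (simp add: conv_commute)
    then have 3: "(K \<odot> L) t = (g \<odot> L) t + (g \<odot> (L \<odot> K)) t" using resolvent_conv[OF g K bL, of t] by simp
    have "H \<odot> L = (\<lambda>t. (E \<odot> L) t + ((K \<odot> E) \<odot> L) t)"
      unfolding H_def[abs_def] by (intro conv_add_left bL bE bounded_L1_conv bK)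
    moreover have "(K \<odot> E) \<odot> L = E \<odot> (L \<odot> K)" by (metis conv_assoc conv_commute bK bE bL)
    ultimately have 4: "(H \<odot> L) t = (E \<odot> L) t + (E \<odot> (L \<odot> K)) t" by simp
    have 5: "(K \<odot> E) t = (E \<odot> K) t" "(L \<odot> K) t = (K \<odot> L) t" by (simp_all add: conv_commute)
    show ?thesis using 1 2 3 4 5 L[of t] E[of t] unfolding K'_def H_def E_def by (simp add: algebra_simps)
  qed
  then show ?thesis using bK' cK' unfolding resolvent_def by blast
qed

section \<open>A priori bound for the \<open>L1\<close> norm of a resolvent\<close>

lemma resolvent_fourier:
  assumes g: "bounded_L1 g" and K: "resolvent g K"
  shows "(1 + fourier K w) * (1 - fourier g w) = 1"
proof -
  have bK: "bounded_L1 K" and E: "K = (\<lambda>t. g t + (g \<odot> K) t)" using K unfolding resolvent_def by auto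
  have "fourier K w = fourier g w + fourier g w * fourier K w"
    using fourier_add[OF g bounded_L1_conv[OF g bK], of w] E by (simp add: fourier_conv[OF g bK])
  then show ?thesis by (simp add: algebra_simps)
qed

lemma bounded_L1_cutoff:
  assumes "causal f" "f \<in> borel_measurable borel" "\<And>t. 0 \<le> t \<Longrightarrow> t \<le> T \<Longrightarrow> cmod (f t) \<le> B" "B \<ge> 0"
  shows "bounded_L1 (\<lambda>t. if t \<le> T then f t else 0)"
proof (rule bounded_L1_compact_support[of _ B "\<bar>T\<bar>"])
  note [measurable] = assms(2)
  show "(\<lambda>t. if t \<le> T then f t else 0) \<in> borel_measurable borel" by measurable
  show "cmod (if t \<le> T then f t else 0) \<le> B" for t using assms(1,3,4) by (cases "t < 0") (auto simp: causal_def)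
  show "(if t \<le> T then f t else 0) = 0" if "\<bar>t\<bar> > \<bar>T\<bar>" for t using that assms(1) by (cases "t < 0") (auto simp: causal_def)
qed

text \<open>
  \<open>t K(t)\<close> solves the Volterra equation with source \<open>F = tg + tg \<odot> K\<close>; the truncation to
  \<open>[0,T]\<close> makes this usable before integrability of \<open>t K(t)\<close> is known.
\<close>

lemma resolvent_moment:
  assumes g: "bounded_L1 g" and cg: "causal g" and tg: "bounded_L1 (\<lambda>t. of_real t * g t)" and K: "resolvent g K"
  defines "F \<equiv> \<lambda>t. of_real t * g t + ((\<lambda>t. of_real t * g t) \<odot> K) t"
  shows "of_real T * K T = F T + (K \<odot> F) T"
proof (cases "T < 0")
  case True
  have cK: "causal K" using K unfolding resolvent_def by auto
  have "causal (\<lambda>t. of_real t * g t)" using cg by (auto simp: causal_def)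
  then have cF: "causal F" using causal_conv[OF _ cK] cg unfolding F_def by (auto simp: causal_def)
  then show ?thesis using True cK causal_conv[OF cK cF] by (auto simp: causal_def)
next
  case False
  have bK: "bounded_L1 K" and cK: "causal K" and E: "\<And>t. K t = g t + (g \<odot> K) t" using K unfolding resolvent_def by auto
  have [measurable]: "K \<in> borel_measurable borel" using bounded_L1_measurable[OF bK] .
  have bF: "bounded_L1 F" unfolding F_def by (intro bounded_L1_add bounded_L1_conv tg bK)
  obtain B where B: "B \<ge> 0" "\<And>t. cmod (K t) \<le> B" using bounded_L1_bound[OF bK] by blast
  define x where "x s = (if s \<le> T then of_real s * K s else 0)" for s
  have x: "bounded_L1 x" unfolding x_def[abs_def]
  proof (rule bounded_L1_cutoff[where B="T * B"])
    show "causal (\<lambda>s. of_real s * K s)" using cK by (auto simp: causal_def)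
    show "(\<lambda>s. of_real s * K s) \<in> borel_measurable borel" by measurable
    show "cmod (of_real t * K t) \<le> T * B" if "0 \<le> t" "t \<le> T" for t
      using that B by (auto simp: norm_mult intro!: mult_mono)
  qed (use False B in auto)
  define y where "y s = x s - (g \<odot> x) s" for s
  have y: "y s = F s" if s: "s \<le> T" for s
  proof -
    \<comment> \<open>For \<open>u > T\<close> causality gives \<open>g (s - u) = 0\<close>, because
      \<open>s \<le> T\<close>; the truncation is thus invisible up to time
      \<open>T\<close>.\<close>
    have gx: "g (s - u) * x u = g (s - u) * (of_real u * K u)" for u
      using s cg by (cases "u \<le> T") (auto simp: x_def causal_def)
    \<comment> \<open>Multiplication by the variable is a derivation for convolution: write
      \<open>s = (s - u) + u\<close> under the integral.\<close>
    have "of_real s * (g \<odot> K) s = (LINT u|lborel. of_real (s - u) * g (s - u) * K u + g (s - u) * x u)"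
      unfolding conv_def by (subst integral_mult_right_zero[symmetric], intro Bochner_Integration.integral_cong refl)
        (simp only: gx, simp add: algebra_simps)
    also have "\<dots> = ((\<lambda>t. of_real t * g t) \<odot> K) s + (g \<odot> x) s"
      using conv_integrable[OF tg bK, of s] conv_integrable[OF g x, of s] by (simp add: conv_def)
    finally show ?thesis unfolding y_def F_def using s E[of s] by (simp add: x_def algebra_simps)
  qed
  have "x T = y T + (K \<odot> y) T"
    using resolvent_solves[OF g K x, of T] by (simp add: y_def[abs_def])
  moreover have "(K \<odot> y) T = (K \<odot> F) T"
    unfolding conv_def
  proof (intro Bochner_Integration.integral_cong refl)
    fix s show "K (T - s) * y s = K (T - s) * F s"
      using y[of s] cK by (cases "s \<le> T") (auto simp: causal_def)
  qed
  ultimately show ?thesis using y[of T] by (simp add: x_def)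
qed

lemma integrable_inverse_1_plus_square_line: "integrable lborel (\<lambda>t::real. inverse (1 + t\<^sup>2))"
  using integrable_inverse_1_plus_square by (simp add: set_integrable_def)

lemma integrable_cmod_power2:
  assumes "bounded_L1 f" shows "integrable lborel (\<lambda>t. (cmod (f t))\<^sup>2)"
  using bounded_L1_integrable_norm[OF bounded_L1_times[OF assms assms]] by (simp add: norm_mult power2_eq_square)

text \<open>The transform of \<open>K\<close> is \<open>fourier g\<close> times one factor
  \<open>1 + fourier K\<close>, that of \<open>t K(t)\<close> is the transform of
  \<open>t g(t)\<close> times two; each factor is at most \<open>1/m\<close>. Two \<open>L2\<close>
  bounds control an \<open>L1\<close> norm because \<open>inverse (1 + t\<^sup>2)\<close> is
  integrable. The right-hand side does not mention \<open>K\<close>, which is what makes the bound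
  uniform.\<close>

lemma resolvent_l1_bound:
  assumes g: "bounded_L1 g" and cg: "causal g" and tg: "bounded_L1 (\<lambda>t. of_real t * g t)" and K: "resolvent g K"
    and m: "m > 0" "\<And>w. m \<le> cmod (1 - fourier g w)"
  shows "l1 K \<le> (1/m)\<^sup>2 * (LINT t|lborel. (cmod (g t))\<^sup>2) + (1/m^2)\<^sup>2 * (LINT t|lborel. (cmod (of_real t * g t))\<^sup>2)
            + (LINT t|(lborel :: real measure). inverse (1 + t\<^sup>2))"
proof -
  have bK: "bounded_L1 K" and cK: "causal K" using K unfolding resolvent_def by auto
  define F where "F t = of_real t * g t + ((\<lambda>t. of_real t * g t) \<odot> K) t" for t
  define x where "x t = F t + (K \<odot> F) t" for t
  have bF: "bounded_L1 F" unfolding F_def[abs_def] by (intro bounded_L1_add bounded_L1_conv tg bK)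
  have bx: "bounded_L1 x" unfolding x_def[abs_def] by (intro bounded_L1_add bounded_L1_conv bF bK)
  have x: "x t = of_real t * K t" for t
    using resolvent_moment[OF g cg tg K, of t] by (simp add: x_def F_def[abs_def])
  have inv: "cmod (1 + fourier K w) \<le> 1 / m" for w
  proof -
    have "cmod (1 + fourier K w) * cmod (1 - fourier g w) = 1"
      using arg_cong[OF resolvent_fourier[OF g K, of w], of cmod] by (simp add: norm_mult)
    moreover have "cmod (1 + fourier K w) * m \<le> cmod (1 + fourier K w) * cmod (1 - fourier g w)"
      using m by (intro mult_left_mono) auto
    ultimately show ?thesis using m by (simp add: field_simps)
  qed
  have FK: "fourier K w = (1 + fourier K w) * fourier g w" for w
    using resolvent_fourier[OF g K, of w] by (simp add: algebra_simps)
  have "cmod (fourier K w) \<le> 1 / m * cmod (fourier g w)" for w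
    by (subst FK) (auto simp only: norm_mult intro!: mult_right_mono inv norm_ge_zero)
  then have 1: "(LINT t|lborel. (cmod (K t))\<^sup>2) \<le> (1/m)\<^sup>2 * (LINT t|lborel. (cmod (g t))\<^sup>2)"
    by (rule l2_le_of_fourier_le[OF bK g])
  have Fx: "fourier x w = (1 + fourier K w) * ((1 + fourier K w) * fourier (\<lambda>t. of_real t * g t) w)" for w
  proof -
    have "fourier F w = (1 + fourier K w) * fourier (\<lambda>t. of_real t * g t) w"
      unfolding F_def[abs_def] by (simp add: fourier_add tg bounded_L1_conv bK fourier_conv algebra_simps)
    then show ?thesis
      unfolding x_def[abs_def] by (simp add: fourier_add bF bounded_L1_conv bK fourier_conv algebra_simps)
  qed
  have "cmod (fourier x w) \<le> 1 / m^2 * cmod (fourier (\<lambda>t. of_real t * g t) w)" for w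
  proof -
    have "cmod (fourier x w) = cmod (1 + fourier K w) * (cmod (1 + fourier K w) * cmod (fourier (\<lambda>t. of_real t * g t) w))"
      by (simp add: Fx norm_mult)
    also have "\<dots> \<le> 1 / m * (1 / m * cmod (fourier (\<lambda>t. of_real t * g t) w))"
      using m by (intro mult_mono mult_right_mono inv) auto
    finally show ?thesis by (simp add: power2_eq_square)
  qed
  then have 2: "(LINT t|lborel. (cmod (x t))\<^sup>2) \<le> (1/m^2)\<^sup>2 * (LINT t|lborel. (cmod (of_real t * g t))\<^sup>2)"
    by (rule l2_le_of_fourier_le[OF bx tg])
  have "l1 K \<le> (LINT t|lborel. (cmod (K t))\<^sup>2 + (cmod (x t))\<^sup>2 + inverse (1 + t\<^sup>2))"
    unfolding l1_def
  proof (intro integral_mono bounded_L1_integrable_norm bK Bochner_Integration.integrable_add integrable_cmod_power2 bx integrable_inverse_1_plus_square_line)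
    fix t :: real
    \<comment> \<open>Completing the square with \<open>a = 1 + t\<^sup>2\<close> gives
      \<open>2 |K| \<le> a |K|^2 + 1/a\<close>, an additive substitute for the Cauchy-Schwarz
      inequality.\<close>
    define a where "a = 1 + t\<^sup>2"
    have a: "a > 0" unfolding a_def by (simp add: add_pos_nonneg)
    have "0 \<le> (a * cmod (K t) - 1)\<^sup>2" by simp
    then have "2 * a * cmod (K t) \<le> a\<^sup>2 * (cmod (K t))\<^sup>2 + 1" by (simp add: power2_eq_square algebra_simps)
    then have "2 * cmod (K t) \<le> a * (cmod (K t))\<^sup>2 + inverse a" using a by (simp add: field_simps power2_eq_square)
    moreover have "a * (cmod (K t))\<^sup>2 = (cmod (K t))\<^sup>2 + (cmod (x t))\<^sup>2" by (simp add: a_def x norm_mult power_mult_distrib algebra_simps)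
    moreover have "0 \<le> a * (cmod (K t))\<^sup>2" "0 \<le> inverse a" using a by auto
    ultimately show "cmod (K t) \<le> (cmod (K t))\<^sup>2 + (cmod (x t))\<^sup>2 + inverse (1 + t\<^sup>2)" unfolding a_def[symmetric] by linarith
  qed
  also have "\<dots> = (LINT t|lborel. (cmod (K t))\<^sup>2) + (LINT t|lborel. (cmod (x t))\<^sup>2) + (LINT t|(lborel :: real measure). inverse (1 + t\<^sup>2))"
    by (simp add: integrable_cmod_power2 bK bx integrable_inverse_1_plus_square_line)
  finally show ?thesis using 1 2 by linarith
qed

subsection \<open>Damping and the method of continuity\<close>

text \<open>The cut at \<open>t < 0\<close> makes the result causal and keeps the exponential at
  most \<open>1\<close> for \<open>s \<ge> 0\<close>. The transform at \<open>w\<close> of the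
  damped kernel is the integral in \<open>D\<close> at the frequency \<open>w - i s\<close>.\<close>

definition damp :: "real \<Rightarrow> (real \<Rightarrow> complex) \<Rightarrow> real \<Rightarrow> complex" where
  "damp s g t = (if t < 0 then 0 else of_real (exp (- (s * t))) * g t)"

lemma causal_damp: "causal (damp s g)"
  by (simp add: causal_def damp_def)

lemma bounded_L1_damp:
  assumes g: "bounded_L1 g" and s: "s \<ge> 0" shows "bounded_L1 (damp s g)"
proof -
  have "bounded_L1 (\<lambda>t. (if t < 0 then 0 else of_real (exp (- (s * t)))) * g t)"
    by (rule bounded_L1_mult[OF g, of _ 1]) (use s in auto)
  moreover have "damp s g = (\<lambda>t. (if t < 0 then 0 else of_real (exp (- (s * t)))) * g t)"
    by (auto simp: damp_def)
  ultimately show ?thesis by simp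
qed

text \<open>\<open>t * exp (- (s * t)) \<le> 1 / s\<close> for \<open>t \<ge> 0\<close>. The bound
  degenerates as \<open>s\<close> tends to \<open>0\<close>, so the a priori estimate is used for
  positive damping only.\<close>

lemma bounded_L1_moment_damp:
  assumes g: "bounded_L1 g" and s: "s > 0" shows "bounded_L1 (\<lambda>t. of_real t * damp s g t)"
proof -
  have b: "cmod (if t < 0 then 0 else of_real (t * exp (- (s * t)))) \<le> 1 / s" for t
  proof (cases "t < 0")
    case False
    have "s * t \<le> exp (s * t)" using exp_ge_add_one_self[of "s * t"] by linarith
    then have "s * t * exp (- (s * t)) \<le> 1" by (simp add: exp_minus field_simps)
    then have "t * exp (- (s * t)) \<le> 1 / s" using s by (simp add: field_simps)
    then show ?thesis using False by (simp del: of_real_mult)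
  qed (use s in simp)
  have "bounded_L1 (\<lambda>t. (if t < 0 then 0 else of_real (t * exp (- (s * t)))) * g t)"
    by (rule bounded_L1_mult[OF g _ b]) measurable
  moreover have "(\<lambda>t. of_real t * damp s g t) = (\<lambda>t. (if t < 0 then 0 else of_real (t * exp (- (s * t)))) * g t)"
    by (auto simp: damp_def)
  ultimately show ?thesis by simp
qed

lemma damp_0: "causal g \<Longrightarrow> damp 0 g = g"
  by (auto simp: damp_def causal_def)

text \<open>The change caused by a given step in \<open>s\<close> is largest when the step starts at
  \<open>0\<close>, since any later start only adds a factor \<open>exp (- (s * t)) \<le> 1\<close>.
  Uniform continuity in \<open>s\<close> is thereby reduced to a single limit at
  \<open>0\<close>.\<close>

lemma l1_damp_diff:
  assumes g: "bounded_L1 g" and s: "0 \<le> s" "0 \<le> s'" "\<bar>s - s'\<bar> \<le> d"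
  shows "l1 (\<lambda>t. damp s g t - damp s' g t) \<le> l1 (\<lambda>t. damp 0 g t - damp d g t)"
  using s
proof (induction s s' rule: linorder_wlog)
  case (le s s')
  show ?case unfolding l1_def
  proof (intro integral_mono bounded_L1_integrable_norm bounded_L1_diff bounded_L1_damp g)
    fix t show "cmod (damp s g t - damp s' g t) \<le> cmod (damp 0 g t - damp d g t)"
    proof (cases "t < 0")
      case False
      have E: "exp (- (s * t)) - exp (- (s' * t)) = exp (- (s * t)) * (1 - exp (- ((s' - s) * t)))"
        by (simp add: algebra_simps flip: exp_add)
      have "(s' - s) * t \<le> d * t" using le False by (intro mult_right_mono) auto
      then have "exp (- (d * t)) \<le> exp (- ((s' - s) * t))" by simp
      moreover have "exp (- ((s' - s) * t)) \<le> 1" using le False by simp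
      moreover have "exp (- (s * t)) \<le> 1" using le False by simp
      ultimately have "exp (- (s * t)) * (1 - exp (- ((s' - s) * t))) \<le> 1 * (1 - exp (- (d * t)))"
        by (intro mult_mono) auto
      moreover have "0 \<le> exp (- (s * t)) * (1 - exp (- ((s' - s) * t)))" using le False by simp
      ultimately have "\<bar>exp (- (s * t)) - exp (- (s' * t))\<bar> \<le> \<bar>1 - exp (- (d * t))\<bar>"
        unfolding E by (simp only: abs_of_nonneg mult_1 order_trans[OF _ abs_ge_self])
      then have "cmod (of_real (exp (- (s * t)) - exp (- (s' * t))) * g t) \<le> cmod (of_real (1 - exp (- (d * t))) * g t)"
        unfolding norm_mult norm_of_real by (intro mult_right_mono) auto
      then show ?thesis using False by (simp add: damp_def algebra_simps)
    qed (simp add: damp_def)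
  qed (use le in auto)
next
  case (sym s s') then show ?case
    using l1_swap[of "damp s g" "damp s' g"] by (simp add: abs_minus_commute)
qed

lemma l1_damp_uniformly_continuous:
  assumes g: "bounded_L1 g" and e: "e > 0"
  obtains d where "d > 0" "\<And>s s'. 0 \<le> s \<Longrightarrow> 0 \<le> s' \<Longrightarrow> \<bar>s - s'\<bar> \<le> d \<Longrightarrow> l1 (\<lambda>t. damp s g t - damp s' g t) < e"
proof -
  have "(\<lambda>n. LINT t|lborel. cmod (damp 0 g t - damp (1 / real (Suc n)) g t)) \<longlonglongrightarrow> (LINT t|(lborel :: real measure). (0::real))"
  proof (rule integral_dominated_convergence[where w="\<lambda>t. cmod (g t)"])
    show "AE t in lborel. (\<lambda>n. cmod (damp 0 g t - damp (1 / real (Suc n)) g t)) \<longlonglongrightarrow> 0"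
    proof (intro AE_I2)
      fix t :: real
      show "(\<lambda>n. cmod (damp 0 g t - damp (1 / real (Suc n)) g t)) \<longlonglongrightarrow> 0"
      proof (cases "t < 0")
        case False
        have "(\<lambda>n. 1 / real (Suc n)) \<longlonglongrightarrow> 0" using LIMSEQ_inverse_real_of_nat by (simp add: divide_inverse)
        then have "(\<lambda>n. cmod (g t - of_real (exp (- (1 / real (Suc n) * t))) * g t)) \<longlonglongrightarrow> cmod (g t - of_real (exp (- (0 * t))) * g t)"
          by (intro tendsto_intros)
        then show ?thesis using False by (simp add: damp_def)
      qed (simp add: damp_def)
    qed
    have "norm (cmod (damp 0 g t - damp (1 / real (Suc n)) g t)) \<le> cmod (g t)" for n t
    proof (cases "t < 0")
      case False
      have "damp 0 g t - damp (1 / real (Suc n)) g t = of_real (1 - exp (- (1 / real (Suc n) * t))) * g t"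
        using False by (simp add: damp_def algebra_simps)
      moreover have "\<bar>1 - exp (- (1 / real (Suc n) * t))\<bar> \<le> 1" using False by simp
      ultimately show ?thesis by (simp add: norm_mult mult_left_le_one_le del: of_real_diff)
    qed (simp add: damp_def)
    then show "AE t in lborel. norm (cmod (damp 0 g t - damp (1 / real (Suc n)) g t)) \<le> cmod (g t)" for n by simp
    have "bounded_L1 (\<lambda>t. damp 0 g t - damp (1 / real (Suc n)) g t)" for n
      by (intro bounded_L1_diff bounded_L1_damp g) auto
    then show "(\<lambda>t. cmod (damp 0 g t - damp (1 / real (Suc n)) g t)) \<in> borel_measurable lborel" for n
      using bounded_L1_measurable by auto
  qed (use bounded_L1_integrable_norm[OF g] in auto)
  then have "eventually (\<lambda>n. (LINT t|lborel. cmod (damp 0 g t - damp (1 / real (Suc n)) g t)) < e) sequentially"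
    using e by (intro order_tendstoD) auto
  then obtain n where "l1 (\<lambda>t. damp 0 g t - damp (1 / real (Suc n)) g t) < e"
    unfolding l1_def by (auto simp: eventually_sequentially)
  then show thesis
    by (intro that[of "1 / real (Suc n)"]) (auto intro: le_less_trans[OF l1_damp_diff[OF g]])
qed

lemma l1_damp_small:
  assumes g: "bounded_L1 g"
  obtains S where "S > 0" "l1 (damp S g) < 1"
proof -
  have "(\<lambda>n. LINT t|lborel. cmod (damp (real (Suc n)) g t)) \<longlonglongrightarrow> (LINT t|(lborel :: real measure). (0::real))"
  proof (rule integral_dominated_convergence[where w="\<lambda>t. cmod (g t)"])
    show "AE t in lborel. (\<lambda>n. cmod (damp (real (Suc n)) g t)) \<longlonglongrightarrow> 0"
      \<comment> \<open>At \<open>t = 0\<close> damping has no effect; this one point is discarded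
        as a null set.\<close>
      using AE_lborel_singleton[of "0::real"]
    proof eventually_elim
      fix t :: real assume t: "t \<noteq> 0"
      show "(\<lambda>n. cmod (damp (real (Suc n)) g t)) \<longlonglongrightarrow> 0"
      proof (cases "t < 0")
        case False
        then have "exp (- t) < 1" using t by simp
        then have "(\<lambda>n. exp (- t) ^ Suc n) \<longlonglongrightarrow> 0"
          by (intro LIMSEQ_Suc LIMSEQ_realpow_zero) auto
        then have "(\<lambda>n. exp (- t) ^ Suc n * cmod (g t)) \<longlonglongrightarrow> 0" by (rule tendsto_mult_left_zero)
        moreover have "cmod (damp (real (Suc n)) g t) = exp (- t) ^ Suc n * cmod (g t)" for n
          using False by (simp add: damp_def norm_mult exp_of_nat_mult[symmetric] del: of_nat_Suc power_Suc)
        ultimately show ?thesis by simp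
      qed (simp add: damp_def)
    qed
    have "norm (cmod (damp (real (Suc n)) g t)) \<le> cmod (g t)" for n t
      by (cases "t < 0") (auto simp: damp_def norm_mult intro!: mult_left_le_one_le)
    then show "AE t in lborel. norm (cmod (damp (real (Suc n)) g t)) \<le> cmod (g t)" for n by simp
    show "(\<lambda>t. cmod (damp (real (Suc n)) g t)) \<in> borel_measurable lborel" for n
      using bounded_L1_measurable[OF bounded_L1_damp[OF g, of "real (Suc n)"]] by auto
  qed (use bounded_L1_integrable_norm[OF g] in auto)
  then have "eventually (\<lambda>n. (LINT t|lborel. cmod (damp (real (Suc n)) g t)) < 1) sequentially"
    by (intro order_tendstoD) auto
  then obtain n where "l1 (damp (real (Suc n)) g) < 1"
    unfolding l1_def by (auto simp: eventually_sequentially)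
  then show thesis by (intro that[of "real (Suc n)"]) auto
qed

lemma fourier_diff_le:
  assumes "bounded_L1 f" "bounded_L1 g" shows "cmod (fourier f w - fourier g w) \<le> l1 (\<lambda>t. f t - g t)"
proof -
  have "fourier (\<lambda>t. f t - g t) w + fourier g w = fourier f w"
    using assms by (subst fourier_add[symmetric]) (auto intro: bounded_L1_diff)
  then have "fourier f w - fourier g w = fourier (\<lambda>t. f t - g t) w" by (simp add: algebra_simps)
  then show ?thesis using norm_fourier_le by simp
qed

text \<open>Only \<open>s\<close> ranges over a compact set. The unbounded \<open>w\<close> causes
  no trouble: the lower bound at the limit \<open>l\<close> of the rates is already uniform in
  \<open>w\<close>, and \<open>fourier_diff_le\<close> transfers it to nearby rates uniformly in
  \<open>w\<close>.\<close>

lemma damp_fourier_bounded_below: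
  assumes g: "bounded_L1 g" and nz: "\<And>s w. 0 \<le> s \<Longrightarrow> fourier (damp s g) w \<noteq> 1"
  obtains m where "m > 0" "\<And>s w. 0 \<le> s \<Longrightarrow> s \<le> S \<Longrightarrow> m \<le> cmod (1 - fourier (damp s g) w)"
proof -
  have "\<exists>m>0. \<forall>s\<in>{0..S}. \<forall>w. m \<le> cmod (1 - fourier (damp s g) w)"
  proof (rule ccontr)
    assume c: "\<not> ?thesis"
    have "\<exists>s\<in>{0..S}. \<exists>w. cmod (1 - fourier (damp s g) w) < 1 / real (Suc n)" for n
    proof -
      have "1 / real (Suc n) > 0" by simp
      with c have "\<not> (\<forall>s\<in>{0..S}. \<forall>w. 1 / real (Suc n) \<le> cmod (1 - fourier (damp s g) w))" by blast
      then show ?thesis by (meson not_le)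
    qed
    then obtain s w where sw: "\<And>n. s n \<in> {0..S}" "\<And>n. cmod (1 - fourier (damp (s n) g) (w n)) < 1 / real (Suc n)"
      by metis
    obtain l r where l: "l \<in> {0..S}" "strict_mono r" "(s \<circ> r) \<longlonglongrightarrow> l"
      using compact_Icc[of 0 S] sw(1) unfolding compact_def by metis
    obtain m where m: "m > 0" "\<And>w. m \<le> cmod (1 - fourier (damp l g) w)"
      using one_minus_fourier_bounded_below[OF bounded_L1_damp[OF g], of l] nz[of l] l(1) by auto
    obtain d where d: "d > 0" "\<And>s s'. 0 \<le> s \<Longrightarrow> 0 \<le> s' \<Longrightarrow> \<bar>s - s'\<bar> \<le> d \<Longrightarrow> l1 (\<lambda>t. damp s g t - damp s' g t) < m/2"
      using l1_damp_uniformly_continuous[OF g, of "m/2"] m(1) by auto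
    have "eventually (\<lambda>n. dist ((s \<circ> r) n) l < d) sequentially" using l(3) d(1) by (rule tendstoD)
    moreover have "(\<lambda>n. 1 / real (Suc n)) \<longlonglongrightarrow> 0" using LIMSEQ_inverse_real_of_nat by (simp add: divide_inverse)
    then have "eventually (\<lambda>n. 1 / real (Suc n) < m/2) sequentially" using m(1) by (intro order_tendstoD) auto
    ultimately have "eventually (\<lambda>n. dist ((s \<circ> r) n) l < d \<and> 1 / real (Suc n) < m/2) sequentially" by (rule eventually_conj)
    then obtain n where n: "dist (s (r n)) l < d" "1 / real (Suc n) < m/2" by (auto simp: eventually_sequentially)
    have "n \<le> r n" using l(2) by (rule seq_suble)
    then have "1 / real (Suc (r n)) \<le> 1 / real (Suc n)" by (intro divide_left_mono) auto
    then have A: "cmod (1 - fourier (damp (s (r n)) g) (w (r n))) < m/2" using sw(2)[of "r n"] n(2) by linarith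
    have "cmod (fourier (damp (s (r n)) g) (w (r n)) - fourier (damp l g) (w (r n))) \<le> l1 (\<lambda>t. damp (s (r n)) g t - damp l g t)"
      using sw(1)[of "r n"] l(1) by (intro fourier_diff_le bounded_L1_damp g) auto
    also have "\<dots> < m/2" using sw(1)[of "r n"] l(1) n(1) by (intro d(2)) (auto simp: dist_real_def)
    finally have "cmod (1 - fourier (damp l g) (w (r n))) < m"
      using A norm_triangle_ineq[of "1 - fourier (damp (s (r n)) g) (w (r n))" "fourier (damp (s (r n)) g) (w (r n)) - fourier (damp l g) (w (r n))"]
      by simp
    then show False using m(2)[of "w (r n)"] by simp
  qed
  then show thesis using that by auto
qed

text \<open>
  Method of continuity in the damping parameter: the Neumann series gives a resolvent for strong
  damping, and the uniform bound on its \<open>L\<^sup>1\<close> norm allows steps of a fixed size towards \<open>0\<close>.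
\<close>

lemma resolvent_exists:
  assumes g: "bounded_L1 g" and cg: "causal g" and nz: "\<And>s w. 0 \<le> s \<Longrightarrow> fourier (damp s g) w \<noteq> 1"
    and sq: "integrable lborel (\<lambda>t. (cmod (of_real t * g t))\<^sup>2)"
  shows "\<exists>K. resolvent g K"
proof -
  obtain S where S: "S > 0" "l1 (damp S g) < 1" using l1_damp_small[OF g] by blast
  obtain m where m: "m > 0" "\<And>s w. 0 \<le> s \<Longrightarrow> s \<le> S \<Longrightarrow> m \<le> cmod (1 - fourier (damp s g) w)"
    using damp_fourier_bounded_below[OF g nz] by blast
  define M where "M = (1/m)\<^sup>2 * (LINT t|lborel. (cmod (g t))\<^sup>2) + (1/m^2)\<^sup>2 * (LINT t|lborel. (cmod (of_real t * g t))\<^sup>2)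
            + (LINT t|(lborel :: real measure). inverse (1 + t\<^sup>2))"
  have M: "M \<ge> 0" unfolding M_def by (intro add_nonneg_nonneg mult_nonneg_nonneg integral_nonneg_AE) auto
  have dle: "cmod (damp s g t) \<le> cmod (g t)" if "s \<ge> 0" for s t
    using that by (cases "t < 0") (auto simp: damp_def norm_mult intro!: mult_left_le_one_le)
  have bound: "l1 K \<le> M" if s: "0 < s" "s \<le> S" and K: "resolvent (damp s g) K" for s K
  proof -
    have bd: "bounded_L1 (damp s g)" "bounded_L1 (\<lambda>t. of_real t * damp s g t)"
      using bounded_L1_damp[OF g] bounded_L1_moment_damp[OF g] s by auto
    have 1: "(LINT t|lborel. (cmod (damp s g t))\<^sup>2) \<le> (LINT t|lborel. (cmod (g t))\<^sup>2)"
      using s by (intro integral_mono integrable_cmod_power2 bd g power_mono dle) auto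
    have 2: "(LINT t|lborel. (cmod (of_real t * damp s g t))\<^sup>2) \<le> (LINT t|lborel. (cmod (of_real t * g t))\<^sup>2)"
      using s by (intro integral_mono integrable_cmod_power2 bd sq power_mono) (auto simp: norm_mult intro!: mult_left_mono dle)
    have "l1 K \<le> (1/m)\<^sup>2 * (LINT t|lborel. (cmod (damp s g t))\<^sup>2) + (1/m^2)\<^sup>2 * (LINT t|lborel. (cmod (of_real t * damp s g t))\<^sup>2)
            + (LINT t|(lborel :: real measure). inverse (1 + t\<^sup>2))"
      using m s by (intro resolvent_l1_bound bd causal_damp K) auto
    also have "\<dots> \<le> M" unfolding M_def by (intro add_mono mult_left_mono 1 2) auto
    finally show ?thesis .
  qed
  \<comment> \<open>The tolerance is the one that \<open>resolvent_perturb\<close> asks for when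
    \<open>l1 K \<le> M\<close>; as \<open>M\<close> does not depend on \<open>s\<close>, one step
    length \<open>d\<close> serves throughout.\<close>
  obtain d where d: "d > 0" "\<And>s s'. 0 \<le> s \<Longrightarrow> 0 \<le> s' \<Longrightarrow> \<bar>s - s'\<bar> \<le> d \<Longrightarrow> l1 (\<lambda>t. damp s g t - damp s' g t) < 1 / (1 + M)"
    using l1_damp_uniformly_continuous[OF g, of "1 / (1 + M)"] M by auto
  have step: "\<exists>K. resolvent (damp (max 0 (S - real k * d)) g) K" for k
  proof (induction k)
    case 0
    then show ?case using S by (auto intro!: resolvent_neumann bounded_L1_damp g causal_damp)
  next
    case (Suc k)
    define s where "s = max 0 (S - real k * d)"
    define s' where "s' = max 0 (S - real (Suc k) * d)"
    have s: "0 \<le> s" "0 \<le> s'" "s \<le> S" "\<bar>s' - s\<bar> \<le> d"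
      using S d(1) by (auto simp: s_def s'_def algebra_simps max_def)
    obtain K where K: "resolvent (damp s g) K" using Suc unfolding s_def by blast
    show ?case
    \<comment> \<open>The bound needs \<open>0 < s\<close>. At \<open>s = 0\<close> the goal is
      already reached, and a step that lands on \<open>0\<close> uses the bound only at its starting
      point.\<close>
    proof (cases "s = 0")
      case True
      then have "s' = 0" using d(1) by (auto simp: s_def s'_def algebra_simps max_def split: if_splits)
      then show ?thesis using K True by (auto simp: s'_def)
    next
      case False
      then have "l1 K \<le> M" using s K by (intro bound) auto
      moreover have "l1 (\<lambda>t. damp s' g t - damp s g t) < 1 / (1 + M)" using s by (intro d(2)) auto
      ultimately have "(1 + l1 K) * l1 (\<lambda>t. damp s' g t - damp s g t) \<le> (1 + M) * l1 (\<lambda>t. damp s' g t - damp s g t)"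
        by (intro mult_right_mono) auto
      also have "\<dots> < (1 + M) * (1 / (1 + M))" using M \<open>l1 (\<lambda>t. damp s' g t - damp s g t) < 1 / (1 + M)\<close>
        by (intro mult_strict_left_mono) auto
      also have "\<dots> = 1" using M by simp
      finally show ?thesis unfolding s'_def[symmetric]
        using s by (intro resolvent_perturb[OF _ _ _ _ K] bounded_L1_damp g causal_damp) auto
    qed
  qed
  obtain k :: nat where "S / d < real k" using reals_Archimedean2 by blast
  then have "max 0 (S - real k * d) = 0" using d(1) by (simp add: field_simps max_def)
  then show ?thesis using step[of k] damp_0[OF cg] by simp
qed

subsection \<open>Weighted bounds\<close>

text \<open>From \<open>r = y + K \<odot> y\<close> with \<open>y = r - g \<odot> r\<close>. Beyond
  \<open>T\<close> nothing is known of \<open>y\<close>, which may have a tail from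
  \<open>g \<odot> r\<close>; causality of \<open>K\<close> hides it at times
  \<open>t \<le> T\<close>.\<close>

lemma volterra_sup_bound:
  assumes g: "bounded_L1 g" and K: "resolvent g K" and r: "bounded_L1 r" "causal r" "\<And>t. t > T \<Longrightarrow> r t = 0"
    and cg: "causal g"
    and y: "AE t in lborel. 0 \<le> t \<longrightarrow> t \<le> T \<longrightarrow> cmod (r t - (g \<odot> r) t) \<le> S" and S: "S \<ge> 0"
  shows "AE t in lborel. cmod (r t) \<le> (1 + l1 K) * S"
proof -
  have bK: "bounded_L1 K" and cK: "causal K" using K unfolding resolvent_def by auto
  define y where "y t = r t - (g \<odot> r) t" for t
  have bdy: "bounded_L1 y" unfolding y_def[abs_def] by (intro bounded_L1_diff bounded_L1_conv g r)
  have cy: "causal y" using r(2) causal_conv[OF cg r(2)] by (auto simp: y_def causal_def)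
  have gr: "cmod ((g \<odot> r) t) \<le> l1 K * S" if t: "t \<le> T" for t
  proof -
    have "(g \<odot> r) t = (K \<odot> y) t" using resolvent_solves[OF g K r(1), of t] by (simp add: y_def[abs_def])
    moreover have "cmod ((K \<odot> y) t) \<le> l1 K * S"
    proof (rule norm_conv_le_l1[OF bK bdy])
      show "AE s in lborel. cmod (K (t - s)) * cmod (y s) \<le> cmod (K (t - s)) * S"
        using y
      proof eventually_elim
        fix s assume s: "0 \<le> s \<longrightarrow> s \<le> T \<longrightarrow> cmod (r s - (g \<odot> r) s) \<le> S"
        consider "s < 0" | "s > T" | "0 \<le> s" "s \<le> T" by linarith
        then show "cmod (K (t - s)) * cmod (y s) \<le> cmod (K (t - s)) * S"
        proof cases
          case 1 then show ?thesis using cy S by (simp add: causal_def)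
        next
          case 2 then show ?thesis using cK t by (simp add: causal_def)
        next
          case 3 then show ?thesis using s by (auto simp: y_def intro!: mult_left_mono)
        qed
      qed
    qed
    ultimately show ?thesis by simp
  qed
  show ?thesis using y
  proof eventually_elim
    fix t assume t: "0 \<le> t \<longrightarrow> t \<le> T \<longrightarrow> cmod (r t - (g \<odot> r) t) \<le> S"
    show "cmod (r t) \<le> (1 + l1 K) * S"
    proof (cases "t < 0 \<or> t > T")
      case True then show ?thesis using r S by (auto simp: causal_def)
    next
      case False
      then have "cmod (r t) \<le> S + l1 K * S"
        using t gr[of t] norm_triangle_ineq[of "r t - (g \<odot> r) t" "(g \<odot> r) t"] by simp
      then show ?thesis by (simp add: algebra_simps)
    qed
  qed
qed

lemma power_Suc_diff_le:
  fixes a b :: real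
  assumes "0 \<le> b" "b \<le> a"
  shows "a ^ Suc k - b ^ Suc k \<le> real (Suc k) * (a - b) * a ^ k"
proof (induction k)
  case (Suc k)
  have "b ^ Suc k \<le> a ^ Suc k" using assms by (intro power_mono)
  then have "(a - b) * b ^ Suc k \<le> (a - b) * a ^ Suc k" using assms by (intro mult_left_mono) auto
  moreover have "a * (a ^ Suc k - b ^ Suc k) \<le> a * (real (Suc k) * (a - b) * a ^ k)"
    using Suc assms by (intro mult_left_mono) auto
  ultimately show ?case by (simp add: algebra_simps)
qed simp

text \<open>
  The weight is raised one power at a time: multiplication by \<open>(1 + t)\<^sup>k\<close> commutes with convolution
  by \<open>g\<close> up to an error controlled by the weight \<open>(1 + t)\<^sup>k\<^sup>-\<^sup>1\<close>.
\<close>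

lemma volterra_weighted_bound:
  assumes g: "bounded_L1 g" and cg: "causal g" and K: "resolvent g K"
    and I: "integrable lborel (\<lambda>t. (1 + \<bar>t\<bar>) ^ n * cmod (g t))"
    and k: "k \<le> n"
  shows "\<exists>C\<ge>0. \<forall>r T S. bounded_L1 r \<longrightarrow> causal r \<longrightarrow> (\<forall>t>T. r t = 0) \<longrightarrow> S \<ge> 0 \<longrightarrow>
    (AE t in lborel. 0 \<le> t \<longrightarrow> t \<le> T \<longrightarrow> (1 + t) ^ k * cmod (r t - (g \<odot> r) t) \<le> S) \<longrightarrow>
    (AE t in lborel. (1 + \<bar>t\<bar>) ^ k * cmod (r t) \<le> C * S)"
  using k
proof (induction k)
  case 0
  show ?case
  proof (intro exI[of _ "1 + l1 K"] conjI allI impI)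
    fix r T S
    assume r: "bounded_L1 r" "causal r" "\<forall>t>T. r t = 0" and S: "0 \<le> S"
      and y: "AE t in lborel. 0 \<le> t \<longrightarrow> t \<le> T \<longrightarrow> (1 + t) ^ 0 * cmod (r t - (g \<odot> r) t) \<le> S"
    show "AE t in lborel. (1 + \<bar>t\<bar>) ^ 0 * cmod (r t) \<le> (1 + l1 K) * S"
      unfolding power_0 mult_1
      by (rule volterra_sup_bound[OF g K r(1,2) r(3)[rule_format] cg y[unfolded power_0 mult_1] S])
  qed simp
next
  case (Suc k)
  then have "k \<le> n" by simp
  from Suc.IH[OF this] obtain C where C0: "C \<ge> 0" and C1: "\<forall>r T S. bounded_L1 r \<longrightarrow> causal r \<longrightarrow> (\<forall>t>T. r t = 0) \<longrightarrow> S \<ge> 0 \<longrightarrow>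
    (AE t in lborel. 0 \<le> t \<longrightarrow> t \<le> T \<longrightarrow> (1 + t) ^ k * cmod (r t - (g \<odot> r) t) \<le> S) \<longrightarrow>
    (AE t in lborel. (1 + \<bar>t\<bar>) ^ k * cmod (r t) \<le> C * S)" by (elim exE conjE) (rule that)
  note C = C0 C1[THEN spec, THEN spec, THEN spec, THEN mp, THEN mp, THEN mp, THEN mp, THEN mp]
  define N where "N = (LINT t|lborel. (1 + \<bar>t\<bar>) ^ n * cmod (g t))"
  have N: "N \<ge> 0" unfolding N_def by (intro integral_nonneg_AE) auto
  \<comment> \<open>For the weighted function the source is at most \<open>S\<close> plus the
    commutator bound \<open>N * (real (Suc k) * C * S)\<close>; \<open>volterra_sup_bound\<close>
    then contributes the factor \<open>1 + l1 K\<close>.\<close>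
  define C' where "C' = (1 + l1 K) * (1 + N * (real (Suc k) * C))"
  have C': "C' \<ge> 0" unfolding C'_def using N C(1) by (intro mult_nonneg_nonneg add_nonneg_nonneg) auto
  show ?case
  proof (intro exI[of _ C'] conjI C' allI impI)
    fix r T S
    assume r: "bounded_L1 r" "causal r" "\<forall>t>T. r t = 0" and S: "0 \<le> S"
      and ae: "AE t in lborel. 0 \<le> t \<longrightarrow> t \<le> T \<longrightarrow> (1 + t) ^ Suc k * cmod (r t - (g \<odot> r) t) \<le> S"
    have "AE t in lborel. 0 \<le> t \<longrightarrow> t \<le> T \<longrightarrow> (1 + t) ^ k * cmod (r t - (g \<odot> r) t) \<le> S"
      using ae
    proof (eventually_elim, intro impI)
      fix t assume t: "0 \<le> t \<longrightarrow> t \<le> T \<longrightarrow> (1 + t) ^ Suc k * cmod (r t - (g \<odot> r) t) \<le> S" "0 \<le> t" "t \<le> T"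
      have "(1 + t) ^ k * cmod (r t - (g \<odot> r) t) \<le> (1 + t) ^ Suc k * cmod (r t - (g \<odot> r) t)"
        using t(2) by (intro mult_right_mono power_increasing) auto
      then show "(1 + t) ^ k * cmod (r t - (g \<odot> r) t) \<le> S" using t(1)[rule_format, OF t(2,3)] by (rule order_trans)
    qed
    then have rC: "AE t in lborel. (1 + \<bar>t\<bar>) ^ k * cmod (r t) \<le> C * S"
      by (rule C(2)[OF r S])
    define W where "W t = (1 + \<bar>t\<bar>) ^ Suc k" for t :: real
    define r' where "r' t = of_real (W t) * r t" for t
    \<comment> \<open>The weight is unbounded, but \<open>r\<close> vanishes off
      \<open>[0,T]\<close>, so it may be replaced by its truncation, which is bounded.\<close>
    have "r' = (\<lambda>t. of_real (if \<bar>t\<bar> \<le> \<bar>T\<bar> then W t else 0) * r t)"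
    proof
      fix t show "r' t = of_real (if \<bar>t\<bar> \<le> \<bar>T\<bar> then W t else 0) * r t"
        using r(2,3) by (cases "t < 0"; cases "t > T") (auto simp: r'_def causal_def)
    qed
    moreover have "bounded_L1 (\<lambda>t. of_real (if \<bar>t\<bar> \<le> \<bar>T\<bar> then W t else 0) * r t)"
    proof (rule bounded_L1_mult[OF r(1)])
      show "cmod (of_real (if \<bar>t\<bar> \<le> \<bar>T\<bar> then W t else 0)) \<le> (1 + \<bar>T\<bar>) ^ Suc k" for t
        by (auto simp: W_def abs_mult power_abs simp del: power_Suc intro!: power_mono)
      show "(\<lambda>t. complex_of_real (if \<bar>t\<bar> \<le> \<bar>T\<bar> then W t else 0)) \<in> borel_measurable borel"
        unfolding W_def by measurable
    qed
    ultimately have r': "bounded_L1 r'" "causal r'" "\<And>t. t > T \<Longrightarrow> r' t = 0"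
      using r(2,3) by (auto simp: r'_def causal_def)
    \<comment> \<open>The difference \<open>W t - W s\<close> is at most
      \<open>(k + 1) * (t - s) * (1 + t)^k\<close>, and
      \<open>1 + t \<le> (1 + (t - s)) * (1 + s)\<close>. Hence \<open>k + 1 \<le> n\<close> powers
      of \<open>1 + (t - s)\<close> fall on \<open>g\<close>, and only \<open>k\<close> powers of
      \<open>1 + s\<close> on \<open>r\<close>, where the previous weight suffices.\<close>
    have comm: "cmod (of_real (W t) * (g \<odot> r) t - (g \<odot> r') t) \<le> N * (real (Suc k) * C * S)" if t: "0 \<le> t" for t
    proof -
      have Wi: "integrable lborel (\<lambda>s. of_real (W t) * (g (t - s) * r s))" "integrable lborel (\<lambda>s. g (t - s) * r' s)"
        using conv_integrable[OF g r(1), of t] conv_integrable[OF g r'(1), of t] by auto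
      have "of_real (W t) * (g \<odot> r) t - (g \<odot> r') t = (LINT s|lborel. of_real (W t) * (g (t - s) * r s) - g (t - s) * r' s)"
        unfolding conv_def Bochner_Integration.integral_diff[OF Wi] integral_mult_right_zero ..
      also have "cmod \<dots> \<le> (LINT s|lborel. cmod (of_real (W t) * (g (t - s) * r s) - g (t - s) * r' s))"
        by (rule integral_norm_bound)
      also have "\<dots> \<le> (LINT s|lborel. (1 + \<bar>t - s\<bar>) ^ n * cmod (g (t - s)) * (real (Suc k) * C * S))"
      proof (rule integral_mono_AE)
        show "integrable lborel (\<lambda>s. cmod (of_real (W t) * (g (t - s) * r s) - g (t - s) * r' s))"
          using Wi by (intro integrable_norm Bochner_Integration.integrable_diff)
        show "integrable lborel (\<lambda>s. (1 + \<bar>t - s\<bar>) ^ n * cmod (g (t - s)) * (real (Suc k) * C * S))"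
          by (intro integrable_mult_left integrable_reflect[OF I])
        show "AE s in lborel. cmod (of_real (W t) * (g (t - s) * r s) - g (t - s) * r' s)
            \<le> (1 + \<bar>t - s\<bar>) ^ n * cmod (g (t - s)) * (real (Suc k) * C * S)"
          using rC
        proof eventually_elim
          fix s assume s: "(1 + \<bar>s\<bar>) ^ k * cmod (r s) \<le> C * S"
          show "cmod (of_real (W t) * (g (t - s) * r s) - g (t - s) * r' s)
            \<le> (1 + \<bar>t - s\<bar>) ^ n * cmod (g (t - s)) * (real (Suc k) * C * S)"
          proof (cases "s < 0 \<or> s > t")
            case True
            then have "g (t - s) * r s = 0" using cg r(2) by (auto simp: causal_def)
            then show ?thesis using C(1) S by (auto simp: r'_def intro!: mult_nonneg_nonneg)
          next
            case False
            then have st: "0 \<le> s" "s \<le> t" by auto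
            have W0: "0 \<le> W t - W s" unfolding W_def using st by (simp add: power_mono del: power_Suc)
            have "of_real (W t) * (g (t - s) * r s) - g (t - s) * r' s = of_real (W t - W s) * (g (t - s) * r s)"
              by (simp add: r'_def algebra_simps)
            then have "cmod (of_real (W t) * (g (t - s) * r s) - g (t - s) * r' s) = (W t - W s) * (cmod (g (t - s)) * cmod (r s))"
              using W0 by (simp add: norm_mult del: of_real_diff)
            also have "\<dots> \<le> (real (Suc k) * ((1 + (t - s)) ^ n * (1 + s) ^ k)) * (cmod (g (t - s)) * cmod (r s))"
            proof (rule mult_right_mono)
              have "W t - W s \<le> real (Suc k) * ((1 + t) - (1 + s)) * (1 + t) ^ k"
                unfolding W_def using st power_Suc_diff_le[of "1 + s" "1 + t" k] by simp
              also have "\<dots> \<le> real (Suc k) * (1 + (t - s)) * ((1 + (t - s)) * (1 + s)) ^ k"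
              proof (intro mult_mono power_mono)
                have "0 \<le> (t - s) * s" using st by simp
                then show "1 + t \<le> (1 + (t - s)) * (1 + s)" by (simp add: algebra_simps)
              qed (use st in auto)
              also have "\<dots> = real (Suc k) * ((1 + (t - s)) ^ Suc k * (1 + s) ^ k)"
                by (simp add: power_mult_distrib)
              also have "\<dots> \<le> real (Suc k) * ((1 + (t - s)) ^ n * (1 + s) ^ k)"
                using st Suc.prems by (intro mult_left_mono mult_right_mono power_increasing) auto
              finally show "W t - W s \<le> real (Suc k) * ((1 + (t - s)) ^ n * (1 + s) ^ k)" .
            qed auto
            also have "\<dots> = ((1 + (t - s)) ^ n * cmod (g (t - s)) * real (Suc k)) * ((1 + s) ^ k * cmod (r s))"
              by (simp only: mult_ac)
            also have "\<dots> \<le> ((1 + (t - s)) ^ n * cmod (g (t - s)) * real (Suc k)) * (C * S)"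
              using s st by (intro mult_left_mono) auto
            finally show ?thesis using st by (simp add: mult_ac)
          qed
        qed
      qed
      also have "\<dots> = N * (real (Suc k) * C * S)"
        using integral_reflect[of "\<lambda>s. (1 + \<bar>s\<bar>) ^ n * cmod (g s)" t] by (simp add: N_def)
      finally show ?thesis .
    qed
    have "AE t in lborel. 0 \<le> t \<longrightarrow> t \<le> T \<longrightarrow> cmod (r' t - (g \<odot> r') t) \<le> S + N * (real (Suc k) * C * S)"
      using ae
    proof (eventually_elim, intro impI)
      fix t assume t: "0 \<le> t \<longrightarrow> t \<le> T \<longrightarrow> (1 + t) ^ Suc k * cmod (r t - (g \<odot> r) t) \<le> S" "0 \<le> t" "t \<le> T"
      have eq: "r' t - (g \<odot> r') t = of_real (W t) * (r t - (g \<odot> r) t) + (of_real (W t) * (g \<odot> r) t - (g \<odot> r') t)"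
        by (simp add: r'_def algebra_simps)
      have "cmod (of_real (W t) * (r t - (g \<odot> r) t)) = (1 + t) ^ Suc k * cmod (r t - (g \<odot> r) t)"
        unfolding norm_mult norm_of_real using t(2) by (simp add: W_def del: power_Suc)
      then have "cmod (of_real (W t) * (r t - (g \<odot> r) t)) \<le> S" using t(1)[rule_format, OF t(2,3)] by simp
      then show "cmod (r' t - (g \<odot> r') t) \<le> S + N * (real (Suc k) * C * S)"
        unfolding eq by (intro order_trans[OF norm_triangle_ineq] add_mono comm t(2))
    qed
    then have "AE t in lborel. cmod (r' t) \<le> (1 + l1 K) * (S + N * (real (Suc k) * C * S))"
      using N C(1) S by (intro volterra_sup_bound[OF g K r' cg]) (auto intro!: add_nonneg_nonneg mult_nonneg_nonneg)
    then show "AE t in lborel. (1 + \<bar>t\<bar>) ^ Suc k * cmod (r t) \<le> C' * S"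
    proof eventually_elim
      fix t assume "cmod (r' t) \<le> (1 + l1 K) * (S + N * (real (Suc k) * C * S))"
      moreover have "cmod (r' t) = (1 + \<bar>t\<bar>) ^ Suc k * cmod (r t)"
        unfolding r'_def norm_mult norm_of_real by (simp add: W_def del: power_Suc)
      ultimately show "(1 + \<bar>t\<bar>) ^ Suc k * cmod (r t) \<le> C' * S" by (simp add: C'_def algebra_simps)
    qed
  qed
qed

text \<open>The weight is submultiplicative: \<open>1 + t \<le> (1 + (t - s)) * (1 + s)\<close>. The
  point is the gain from an almost everywhere bound on \<open>r\<close> to a bound on
  \<open>g \<odot> r\<close> at every \<open>t\<close>.\<close>

lemma conv_weighted_le:
  assumes g: "bounded_L1 g" and cg: "causal g" and r: "bounded_L1 r" "causal r"
    and I: "integrable lborel (\<lambda>t. (1 + \<bar>t\<bar>) ^ n * cmod (g t))"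
    and ae: "AE s in lborel. (1 + \<bar>s\<bar>) ^ n * cmod (r s) \<le> B" and B: "B \<ge> 0" and t: "0 \<le> t"
  shows "(1 + t) ^ n * cmod ((g \<odot> r) t) \<le> (LINT s|lborel. (1 + \<bar>s\<bar>) ^ n * cmod (g s)) * B"
proof -
  have "(1 + t) ^ n * cmod ((g \<odot> r) t) \<le> (1 + t) ^ n * (LINT s|lborel. cmod (g (t - s)) * cmod (r s))"
    using t by (intro mult_left_mono norm_conv_le g r) auto
  also have "\<dots> = (LINT s|lborel. (1 + t) ^ n * (cmod (g (t - s)) * cmod (r s)))" by simp
  also have "\<dots> \<le> (LINT s|lborel. (1 + \<bar>t - s\<bar>) ^ n * cmod (g (t - s)) * B)"
  proof (rule integral_mono_AE)
    show "integrable lborel (\<lambda>s. (1 + t) ^ n * (cmod (g (t - s)) * cmod (r s)))"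
      using conv_integrable[OF g r(1), of t, THEN integrable_norm] unfolding norm_mult by (rule integrable_mult_right)
    show "integrable lborel (\<lambda>s. (1 + \<bar>t - s\<bar>) ^ n * cmod (g (t - s)) * B)"
      by (intro integrable_mult_left integrable_reflect[OF I])
    show "AE s in lborel. (1 + t) ^ n * (cmod (g (t - s)) * cmod (r s)) \<le> (1 + \<bar>t - s\<bar>) ^ n * cmod (g (t - s)) * B"
      using ae
    proof eventually_elim
      fix s assume s: "(1 + \<bar>s\<bar>) ^ n * cmod (r s) \<le> B"
      show "(1 + t) ^ n * (cmod (g (t - s)) * cmod (r s)) \<le> (1 + \<bar>t - s\<bar>) ^ n * cmod (g (t - s)) * B"
      proof (cases "s < 0 \<or> s > t")
        case True
        then have z: "cmod (g (t - s)) * cmod (r s) = 0" using cg r(2) by (auto simp: causal_def)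
        show ?thesis unfolding z using B by simp
      next
        case False
        then have st: "0 \<le> s" "s \<le> t" by auto
        then have "0 \<le> (t - s) * s" by simp
        then have "1 + t \<le> (1 + (t - s)) * (1 + s)" by (simp add: algebra_simps)
        then have "(1 + t) ^ n \<le> ((1 + (t - s)) * (1 + s)) ^ n" using t by (intro power_mono) auto
        then have "(1 + t) ^ n * (cmod (g (t - s)) * cmod (r s)) \<le> ((1 + (t - s)) * (1 + s)) ^ n * (cmod (g (t - s)) * cmod (r s))"
          by (intro mult_right_mono) auto
        also have "\<dots> = (1 + (t - s)) ^ n * cmod (g (t - s)) * ((1 + s) ^ n * cmod (r s))"
          by (simp only: power_mult_distrib mult_ac)
        also have "\<dots> \<le> (1 + (t - s)) ^ n * cmod (g (t - s)) * B" using s st by (intro mult_left_mono) auto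
        finally show ?thesis using st by simp
      qed
    qed
  qed
  also have "\<dots> = (LINT s|lborel. (1 + \<bar>s\<bar>) ^ n * cmod (g s)) * B"
    using integral_reflect[of "\<lambda>s. (1 + \<bar>s\<bar>) ^ n * cmod (g s)" t] by simp
  finally show ?thesis .
qed

section \<open>Borel representatives of Lebesgue measurable functions\<close>

lemma integral_lebesgue_AE:
  fixes f f' :: "real \<Rightarrow> 'a::euclidean_space"
  assumes f': "f' \<in> borel_measurable borel" and ae: "AE x in lborel. f x = f' x"
  shows "integral\<^sup>L lebesgue f = integral\<^sup>L lborel f'" "integrable lebesgue f \<longleftrightarrow> integrable lborel f'"
proof -
  have m': "f' \<in> borel_measurable lebesgue" using f' by (simp add: measurable_completion)
  have ae': "AE x in lebesgue. f' x = f x" using AE_completion[OF ae] by (auto elim: eventually_mono)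
  have m: "f \<in> borel_measurable lebesgue" by (rule borel_measurable_AE[OF m' ae'])
  have "integral\<^sup>L lebesgue f = integral\<^sup>L lebesgue f'" by (rule integral_cong_AE[OF m m' AE_completion[OF ae]])
  then show "integral\<^sup>L lebesgue f = integral\<^sup>L lborel f'" using f' by (simp add: integral_completion)
  have "integrable lebesgue f \<longleftrightarrow> integrable lebesgue f'" by (rule integrable_cong_AE[OF m m' AE_completion[OF ae]])
  then show "integrable lebesgue f \<longleftrightarrow> integrable lborel f'" using f' by (simp add: integrable_completion)
qed

text \<open>The convolution calculus, with its uses of Fubini, is set up for Borel functions.
  Resetting the representative to \<open>0\<close> on negative times and where its modulus exceeds
  \<open>B\<close> changes a null set only, and makes bound and causality hold everywhere.\<close>

lemma borel_representative:
  fixes f :: "real \<Rightarrow> complex"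
  assumes f: "f \<in> borel_measurable lebesgue" and b: "AE t in lborel. cmod (f t) \<le> B" and B: "B \<ge> 0" and c: "causal f"
  obtains f' where "f' \<in> borel_measurable borel" "causal f'" "\<And>t. cmod (f' t) \<le> B" "AE t in lborel. f t = f' t"
proof -
  obtain u where u: "u \<in> borel_measurable lborel" "AE t in lborel. Re (f t) = u t"
    using completion_ex_borel_measurable_real[of "\<lambda>t. Re (f t)" lborel] f by auto
  obtain v where v: "v \<in> borel_measurable lborel" "AE t in lborel. Im (f t) = v t"
    using completion_ex_borel_measurable_real[of "\<lambda>t. Im (f t)" lborel] f by auto
  have [measurable]: "u \<in> borel_measurable borel" "v \<in> borel_measurable borel" using u v by auto
  define h where "h t = of_real (u t) + \<i> * of_real (v t)" for t
  have [measurable]: "h \<in> borel_measurable borel" unfolding h_def[abs_def] by measurable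
  have fh: "AE t in lborel. f t = h t" using u(2) v(2)
    by eventually_elim (auto simp: h_def complex_eq_iff)
  define f' where "f' t = (if 0 \<le> t \<and> cmod (h t) \<le> B then h t else 0)" for t
  show thesis
  proof (rule that[of f'])
    show "f' \<in> borel_measurable borel" unfolding f'_def[abs_def] by measurable
    show "causal f'" by (simp add: causal_def f'_def)
    show "cmod (f' t) \<le> B" for t using B by (simp add: f'_def)
    show "AE t in lborel. f t = f' t" using fh b
      by eventually_elim (use c in \<open>auto simp: f'_def causal_def not_le\<close>)
  qed
qed

lemma AE_reflect:
  assumes "AE s in lborel. P s" shows "AE s in lborel. P (t - s :: real)"
proof -
  obtain N where N: "N \<in> null_sets lborel" "{s. \<not> P s} \<subseteq> N"
    using assms by (auto simp: eventually_ae_filter)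
  have [measurable]: "N \<in> sets borel" using N(1) by auto
  have "AE s in lborel. s \<notin> N" using N(1) by (rule AE_not_in)
  then have "AE s in lborel. t + (-1) * s \<notin> N"
    by (intro AE_borel_affine) auto
  then show ?thesis by eventually_elim (use N(2) in auto)
qed


theorem proposition4p1:
  fixes n :: nat and G :: "real \<Rightarrow> complex"
  assumes "G absolutely_integrable_on {0..}"
    and "essentially_bounded_on G {0..}"
    and "(\<lambda>t. t ^ 4 * (cmod (G t))\<^sup>2) absolutely_integrable_on {0..}"
    and "(\<lambda>t. t ^ n * cmod (G t)) absolutely_integrable_on {0..}"
    and "\<forall>\<omega>\<in>lower_half_plane. D G \<omega> \<noteq> 0"
  shows "\<exists>C::real. C \<ge> 0 \<and>
    (\<forall>F R. measurable_locally_bounded F \<longrightarrow> volterra_solution G F R \<longrightarrow>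
      (\<forall>T>0. (SUP t\<in>{0..T}. (1 + t) ^ n * cmod (R t))
               \<le> C * (SUP t\<in>{0..T}. (1 + t) ^ n * cmod (F t))))"
proof -
  define G0 where "G0 t = indicator {0..} t *\<^sub>R G t" for t :: real
  have G0: "integrable lebesgue G0" using assms(1) by (simp add: set_integrable_def G0_def[abs_def])
  have cG0: "causal G0" by (simp add: causal_def G0_def)
  obtain M where "AE t in lebesgue. t \<in> {0..} \<longrightarrow> cmod (G t) \<le> M"
    using assms(2) unfolding essentially_bounded_on_def by blast
  then have "AE t in lborel. t \<in> {0..} \<longrightarrow> cmod (G t) \<le> M" unfolding AE_completion_iff .
  then have "AE t in lborel. cmod (G0 t) \<le> max 0 M"
    by eventually_elim (auto simp: G0_def indicator_def)
  then obtain g where gm [measurable]: "g \<in> borel_measurable borel" and cg: "causal g"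
    and gb: "\<And>t. cmod (g t) \<le> max 0 M" and gG: "AE t in lborel. G0 t = g t"
    using borel_representative[OF borel_measurable_integrable[OF G0] _ _ cG0, of "max 0 M"] by auto
  have "integrable lborel g" using integral_lebesgue_AE(2)[OF gm gG] G0 by simp
  then have g: "bounded_L1 g" using gb unfolding bounded_L1_def by auto
  have Gg: "AE t in lborel. 0 \<le> t \<longrightarrow> G t = g t" using gG by eventually_elim (auto simp: G0_def)
  have I4: "integrable lborel (\<lambda>t. indicator {0..} t *\<^sub>R (t ^ 4 * (cmod (g t))\<^sup>2))"
  proof (subst integral_lebesgue_AE(2)[symmetric])
    show "AE t in lborel. indicator {0..} t *\<^sub>R (t ^ 4 * (cmod (G t))\<^sup>2) = indicator {0..} t *\<^sub>R (t ^ 4 * (cmod (g t))\<^sup>2)"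
      using Gg by eventually_elim (auto simp: indicator_def)
    show "integrable lebesgue (\<lambda>t. indicator {0..} t *\<^sub>R (t ^ 4 * (cmod (G t))\<^sup>2))"
      using assms(3) by (simp add: set_integrable_def)
  qed measurable
  have In: "integrable lborel (\<lambda>t. indicator {0..} t *\<^sub>R (t ^ n * cmod (g t)))"
  proof (subst integral_lebesgue_AE(2)[symmetric])
    show "AE t in lborel. indicator {0..} t *\<^sub>R (t ^ n * cmod (G t)) = indicator {0..} t *\<^sub>R (t ^ n * cmod (g t))"
      using Gg by eventually_elim (auto simp: indicator_def)
    show "integrable lebesgue (\<lambda>t. indicator {0..} t *\<^sub>R (t ^ n * cmod (G t)))"
      using assms(4) by (simp add: set_integrable_def)
  qed measurable
  have sq: "integrable lborel (\<lambda>t. (cmod (of_real t * g t))\<^sup>2)"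
  proof (rule Bochner_Integration.integrable_bound[OF Bochner_Integration.integrable_add[OF integrable_cmod_power2[OF g] I4]])
    have "(cmod (of_real t * g t))\<^sup>2 \<le> (cmod (g t))\<^sup>2 + indicator {0..} t *\<^sub>R (t ^ 4 * (cmod (g t))\<^sup>2)" for t
    proof (cases "t < 0")
      case False
      have "0 \<le> (t\<^sup>2 - 1)\<^sup>2" by simp
      \<comment> \<open>This interpolation, \<open>t^2 \<le> 1 + t^4\<close>, is how the moment
        hypothesis and the square integrability of \<open>g\<close> yield that of
        \<open>t g(t)\<close>.\<close>
      then have "2 * t\<^sup>2 \<le> 1 + t ^ 4" by (simp add: power2_eq_square power4_eq_xxxx algebra_simps)
      then have "t\<^sup>2 \<le> 1 + t ^ 4" using zero_le_power2[of t] by linarith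
      then have "t\<^sup>2 * (cmod (g t))\<^sup>2 \<le> (1 + t ^ 4) * (cmod (g t))\<^sup>2" by (intro mult_right_mono) auto
      then show ?thesis using False by (simp add: norm_mult power_mult_distrib algebra_simps)
    qed (use cg in \<open>simp add: causal_def\<close>)
    then show "AE t in lborel. norm ((cmod (of_real t * g t))\<^sup>2)
        \<le> norm ((cmod (g t))\<^sup>2 + indicator {0..} t *\<^sub>R (t ^ 4 * (cmod (g t))\<^sup>2))"
      by (intro AE_I2) (simp add: order_trans[OF _ abs_ge_self])
  qed measurable
  have I: "integrable lborel (\<lambda>t. (1 + \<bar>t\<bar>) ^ n * cmod (g t))"
  proof (rule Bochner_Integration.integrable_bound[OF integrable_mult_right[OF Bochner_Integration.integrable_add[OF bounded_L1_integrable_norm[OF g] In], of "2 ^ n"]])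
    have "(1 + \<bar>t\<bar>) ^ n * cmod (g t) \<le> 2 ^ n * (cmod (g t) + indicator {0..} t *\<^sub>R (t ^ n * cmod (g t)))" for t
    proof (cases "t < 0")
      case False
      have "(1 + t) ^ n \<le> (2 * max 1 t) ^ n" using False by (intro power_mono) auto
      also have "\<dots> \<le> 2 ^ n * (1 + t ^ n)" using False by (auto simp: power_mult_distrib max_def)
      finally have "(1 + t) ^ n * cmod (g t) \<le> 2 ^ n * (1 + t ^ n) * cmod (g t)" by (rule mult_right_mono) auto
      then show ?thesis using False by (simp add: algebra_simps)
    qed (use cg in \<open>simp add: causal_def\<close>)
    then show "AE t in lborel. norm ((1 + \<bar>t\<bar>) ^ n * cmod (g t))
        \<le> norm (2 ^ n * (cmod (g t) + indicator {0..} t *\<^sub>R (t ^ n * cmod (g t))))"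
      by (intro AE_I2) (simp add: order_trans[OF _ abs_ge_self])
  qed measurable
  \<comment> \<open>The frequency is \<open>w - i s\<close>, that is \<open>Complex w (- s)\<close>,
    which lies in the lower half plane exactly because \<open>s \<ge> 0\<close>.\<close>
  have nz: "fourier (damp s g) w \<noteq> 1" if s: "0 \<le> s" for s w
  proof -
    have d [measurable]: "damp s g \<in> borel_measurable borel" using bounded_L1_measurable[OF bounded_L1_damp[OF g s]] .
    have e: "exp (- \<i> * Complex w (- s) * of_real t) = of_real (exp (- (s * t))) * cis (- (w * t))" for t
    proof -
      have "- \<i> * Complex w (- s) * of_real t = of_real (- (s * t)) + \<i> * of_real (- (w * t))"
        by (simp add: complex_eq_iff)
      then show ?thesis by (simp only: exp_add exp_of_real cis_conv_exp)
    qed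
    have "(LINT t:{0..}|lebesgue. G t * exp (- \<i> * Complex w (- s) * of_real t)) = fourier (damp s g) w"
      unfolding set_lebesgue_integral_def fourier_def
    proof (rule integral_lebesgue_AE(1))
      show "(\<lambda>t. damp s g t * cis (- (w * t))) \<in> borel_measurable borel" unfolding cis_conv_exp by measurable
      show "AE t in lborel. indicator {0..} t *\<^sub>R (G t * exp (- \<i> * Complex w (- s) * of_real t)) = damp s g t * cis (- (w * t))"
        unfolding e using Gg by eventually_elim (auto simp: damp_def indicator_def mult_ac)
    qed
    then have "D G (Complex w (- s)) = 1 - fourier (damp s g) w" by (simp add: D_def)
    moreover have "Complex w (- s) \<in> lower_half_plane" using s by (simp add: lower_half_plane_def)
    ultimately show ?thesis using assms(5) by fastforce
  qed
  obtain K where K: "resolvent g K" using resolvent_exists[OF g cg nz sq] by blast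
  from volterra_weighted_bound[OF g cg K I order_refl] obtain C where C0: "C \<ge> 0"
    and C1: "\<forall>r T S. bounded_L1 r \<longrightarrow> causal r \<longrightarrow> (\<forall>t>T. r t = 0) \<longrightarrow> S \<ge> 0 \<longrightarrow>
    (AE t in lborel. 0 \<le> t \<longrightarrow> t \<le> T \<longrightarrow> (1 + t) ^ n * cmod (r t - (g \<odot> r) t) \<le> S) \<longrightarrow>
    (AE t in lborel. (1 + \<bar>t\<bar>) ^ n * cmod (r t) \<le> C * S)" by (elim exE conjE) (rule that)
  note C = C0 C1[THEN spec, THEN spec, THEN spec, THEN mp, THEN mp, THEN mp, THEN mp, THEN mp]
  define N where "N = (LINT t|lborel. (1 + \<bar>t\<bar>) ^ n * cmod (g t))"
  have N: "N \<ge> 0" unfolding N_def by (intro integral_nonneg_AE) auto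
  show ?thesis
  proof (intro exI[of _ "1 + N * C"] conjI allI impI)
    show "0 \<le> 1 + N * C" using N C(1) by simp
    fix F R :: "real \<Rightarrow> complex" and T :: real
    assume F: "measurable_locally_bounded F" and sol: "volterra_solution G F R" and T: "0 < T"
    have Rm: "R \<in> borel_measurable (lebesgue_on {0..})" and Req: "\<And>t. 0 \<le> t \<Longrightarrow> R t = F t + (LINT s:{0..t}|lebesgue. G (t - s) * R s)"
      using sol unfolding volterra_solution_def measurable_locally_bounded_def by auto
    have "bounded (R ` {0..T})" "bounded (F ` {0..T})"
      using sol F T unfolding volterra_solution_def measurable_locally_bounded_def by auto
    then obtain B BF where "\<forall>x\<in>R ` {0..T}. cmod x \<le> B" "\<forall>x\<in>F ` {0..T}. cmod x \<le> BF"
      unfolding bounded_iff by blast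
    then have B: "cmod (R t) \<le> B" and BF: "cmod (F t) \<le> BF" if "0 \<le> t" "t \<le> T" for t
      using that by auto
    have B0: "B \<ge> 0" using B[of 0] T norm_ge_zero[of "R 0"] by linarith
    \<comment> \<open>Measurability of \<open>R\<close> is known on \<open>[0,\<infinity>)\<close>
      only and its values at negative times are arbitrary, so it is first extended by zero and then
      cut at \<open>T\<close>, where it is bounded.\<close>
    define Rp where "Rp t = (if t \<in> {0..} then R t else 0)" for t
    have Rp: "Rp \<in> borel_measurable lebesgue" unfolding Rp_def[abs_def] by (rule borel_measurable_if_I[OF Rm]) simp
    define R0 where "R0 t = (if t \<in> {0..T} then Rp t else 0)" for t
    have R0: "R0 \<in> borel_measurable lebesgue" unfolding R0_def[abs_def] by (intro measurable_If_set Rp) auto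
    have R0b: "AE t in lborel. cmod (R0 t) \<le> B" using B B0 by (auto simp: R0_def Rp_def)
    have cR0: "causal R0" by (simp add: causal_def R0_def)
    obtain r0 where r0: "r0 \<in> borel_measurable borel" "causal r0" "\<And>t. cmod (r0 t) \<le> B" "AE t in lborel. R0 t = r0 t"
      by (rule borel_representative[OF R0 R0b B0 cR0]) (rule that)
    define r where "r t = (if t \<le> T then r0 t else 0)" for t
    have r: "bounded_L1 r" unfolding r_def[abs_def] by (rule bounded_L1_cutoff[OF r0(2,1,3) B0])
    have cr: "causal r" using r0(2) by (auto simp: r_def causal_def)
    have rR: "AE t in lborel. 0 \<le> t \<longrightarrow> t \<le> T \<longrightarrow> R t = r t"
      using r0(4) by eventually_elim (auto simp: r_def R0_def Rp_def)
    \<comment> \<open>This holds at every \<open>t\<close> in \<open>[0,T]\<close>: passing to the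
      representatives \<open>g\<close> and \<open>r\<close> changes the integrand on a null set, and
      beyond \<open>t\<close> causality of \<open>g\<close> removes the integrand.\<close>
    have eq: "R t = F t + (g \<odot> r) t" if t: "0 \<le> t" "t \<le> T" for t
    proof -
      have "(LINT s:{0..t}|lebesgue. G (t - s) * R s) = (g \<odot> r) t"
        unfolding set_lebesgue_integral_def conv_def
      proof (rule integral_lebesgue_AE(1))
        show "(\<lambda>s. g (t - s) * r s) \<in> borel_measurable borel"
          using bounded_L1_measurable[OF r] by measurable
        show "AE s in lborel. indicator {0..t} s *\<^sub>R (G (t - s) * R s) = g (t - s) * r s"
          using rR AE_reflect[OF Gg, of t]
          by eventually_elim (use t cr cg in \<open>auto simp: indicator_def causal_def not_le\<close>)
      qed
      then show ?thesis using Req[OF t(1)] by simp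
    qed
    define S where "S = (SUP t\<in>{0..T}. (1 + t) ^ n * cmod (F t))"
    \<comment> \<open>Boundedness of the set is what makes the real supremum \<open>S\<close> an
      upper bound for its members.\<close>
    have bdd: "bdd_above ((\<lambda>t. (1 + t) ^ n * cmod (F t)) ` {0..T})"
    proof (rule bdd_aboveI2)
      fix t assume "t \<in> {0..T}"
      then show "(1 + t) ^ n * cmod (F t) \<le> (1 + T) ^ n * BF"
        using BF by (intro mult_mono power_mono) auto
    qed
    have FS: "(1 + t) ^ n * cmod (F t) \<le> S" if "0 \<le> t" "t \<le> T" for t
      unfolding S_def using that by (intro cSUP_upper bdd) auto
    have S: "S \<ge> 0" using FS[of 0] T order_trans[OF norm_ge_zero, of "F 0" S] by simp
    have "AE t in lborel. 0 \<le> t \<longrightarrow> t \<le> T \<longrightarrow> (1 + t) ^ n * cmod (r t - (g \<odot> r) t) \<le> S"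
      using rR
    proof (eventually_elim, intro impI)
      fix t assume t: "0 \<le> t \<longrightarrow> t \<le> T \<longrightarrow> R t = r t" "0 \<le> t" "t \<le> T"
      then have "r t - (g \<odot> r) t = F t" using eq[of t] by (metis add_diff_cancel_right')
      then show "(1 + t) ^ n * cmod (r t - (g \<odot> r) t) \<le> S" using FS[OF t(2,3)] by simp
    qed
    then have rb: "AE t in lborel. (1 + \<bar>t\<bar>) ^ n * cmod (r t) \<le> C * S"
      by (intro C(2)[OF r cr _ S]) (auto simp: r_def)
    \<comment> \<open>The bound on \<open>r\<close> holds only almost everywhere, too little for a
      supremum. One more pass through the equation repairs this: \<open>F\<close> contributes the
      \<open>1\<close> and the convolution the \<open>N * C\<close> of the final constant.\<close>
    have "(1 + t) ^ n * cmod (R t) \<le> (1 + N * C) * S" if t: "t \<in> {0..T}" for t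
    proof -
      have "(1 + t) ^ n * cmod ((g \<odot> r) t) \<le> N * (C * S)"
        unfolding N_def using t C(1) S by (intro conv_weighted_le[OF g cg r cr I rb]) auto
      moreover have "(1 + t) ^ n * cmod (R t) \<le> (1 + t) ^ n * (cmod (F t) + cmod ((g \<odot> r) t))"
        using t eq[of t] norm_triangle_ineq[of "F t" "(g \<odot> r) t"] by (intro mult_left_mono) auto
      ultimately show ?thesis using FS[of t] t by (simp add: algebra_simps)
    qed
    then show "(SUP t\<in>{0..T}. (1 + t) ^ n * cmod (R t)) \<le> (1 + N * C) * (SUP t\<in>{0..T}. (1 + t) ^ n * cmod (F t))"
      unfolding S_def[symmetric] using T by (intro cSUP_least) auto
  qed
qed

end
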